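(* For any mergeable MSD problem whose feasibility check runs in time $f(n)$, an exact solution on an $n$-point metric space with $k$ clusters can be computed in time $n^{O(k)}f(n)$. In particular, an exact solution for Fair MSD (e.g. MSD where every cluster must be $b$-balanced) can be obtained in time $n^{O(k)}$.
   Context: MSD: partition a finite metric space $(X,d)$ into at most $k$ disjoint clusters minimizing $\sum_i\operatorname{diam}(C_i)$, $\operatorname{diam}(C)=\max_{x,y\in C}d(x,y)$. A constrained clustering problem (a set of feasible partitions) is mergeable if for every feasible solution, the solution obtained by merging any two of its clusters into one is again feasible; it is assumed there is a procedure checking feasibility of a solution in time $f(n)$. Mergeable MSD asks for a minimum-cost feasible partition with at most $k$ clusters. Example of a fairness (Fair MSD) constraint: given a partition of $X$ into two colors $X_1,X_2$ and $b\in[0,1]$, a cluster $C$ is $b$-balanced if $\min\{|C\cap X_2|/|C\cap X_1|,\ |C\cap X_1|/|C\cap X_2|\}\ge b$; requiring all clusters to be $b$-balanced is mergeable and checkable in time $O(n)$. *)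

theory Defs
  imports "HOL-Analysis.Analysis" "HOL-Library.Disjoint_Sets"
begin

section \<open>Machine model\<close>

text \<open>
  Running times refer to a unit-cost real-number pointer machine: a value is an exact real
  number or a binary tree of cells with reals (or \<open>Null\<close>) at the leaves, and a machine program is
  an expression with while loops. Every elementary step (variable access, constant,
  cell construction and selection, real arithmetic, comparison, test, binding) costs one time
  unit. As usual for the real RAM there is no rounding operation, and the only constants in
  programs are natural numbers, so that no program can carry an infinite amount of
  information. A value is passed by reference, i.e. its size does not enter the cost.
\<close>

datatype val = Num real | Null | Cell val val

datatype unop = Fst | Snd | IsNum | IsNull
datatype binop = Plus | Minus | Times | Divide | Less | MkCell

datatype prog =
    Var nat
  | Const nat
  | NullC
  | Op1 unop prog
  | Op2 binop prog prog
  | Ite prog prog prog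
  | Bind prog prog
  | While prog prog

definition truth :: "bool \<Rightarrow> val" where
  "truth b = Num (if b then 1 else 0)"

fun un_op :: "unop \<Rightarrow> val \<Rightarrow> val option" where
  "un_op Fst (Cell u v) = Some u"
| "un_op Snd (Cell u v) = Some v"
| "un_op IsNum u = Some (truth (\<exists>x. u = Num x))"
| "un_op IsNull u = Some (truth (u = Null))"
| "un_op _ _ = None"

fun bin_op :: "binop \<Rightarrow> val \<Rightarrow> val \<Rightarrow> val option" where
  "bin_op Plus (Num x) (Num y) = Some (Num (x + y))"
| "bin_op Minus (Num x) (Num y) = Some (Num (x - y))"
| "bin_op Times (Num x) (Num y) = Some (Num (x * y))"
| "bin_op Divide (Num x) (Num y) = (if y = 0 then None else Some (Num (x / y)))"
| "bin_op Less (Num x) (Num y) = Some (truth (x < y))"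
| "bin_op MkCell u v = Some (Cell u v)"
| "bin_op _ _ _ = None"

text \<open>
  \<open>run E p v t\<close>: in environment \<open>E\<close> (variables are de Bruijn indices) the program \<open>p\<close> halts
  with result \<open>v\<close> after exactly \<open>t\<close> steps. \<open>While c b\<close> uses variable 0 as its state: as long as
  \<open>c\<close> is non-zero, the state is replaced by the value of \<open>b\<close>; the result is the final state.
  A program that diverges or applies an operation outside its domain has no result.
\<close>

inductive run :: "val list \<Rightarrow> prog \<Rightarrow> val \<Rightarrow> nat \<Rightarrow> bool" where
  run_Var: "i < length E \<Longrightarrow> run E (Var i) (E ! i) 1"
| run_Const: "run E (Const m) (Num (real m)) 1"
| run_NullC: "run E NullC Null 1"
| run_Op1: "run E p u s \<Longrightarrow> un_op f u = Some v \<Longrightarrow> run E (Op1 f p) v (s + 1)"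
| run_Op2: "run E p u s \<Longrightarrow> run E q w t \<Longrightarrow> bin_op f u w = Some v
    \<Longrightarrow> run E (Op2 f p q) v (s + t + 1)"
| run_Ite_true: "run E c (Num x) s \<Longrightarrow> x \<noteq> 0 \<Longrightarrow> run E p v t \<Longrightarrow> run E (Ite c p q) v (s + t + 1)"
| run_Ite_false: "run E c (Num 0) s \<Longrightarrow> run E q v t \<Longrightarrow> run E (Ite c p q) v (s + t + 1)"
| run_Bind: "run E p u s \<Longrightarrow> run (u # E) q v t \<Longrightarrow> run E (Bind p q) v (s + t + 1)"
| run_While_stop: "run (u # E) c (Num 0) s \<Longrightarrow> run (u # E) (While c b) u (s + 1)"
| run_While_step: "run (u # E) c (Num x) r \<Longrightarrow> x \<noteq> 0 \<Longrightarrow> run (u # E) b w s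
    \<Longrightarrow> run (w # E) (While c b) v t \<Longrightarrow> run (u # E) (While c b) v (r + s + t + 1)"

lemma run_deterministic:
  assumes "run E p v t" and "run E p v' t'"
  shows "v = v' \<and> t = t'"
  using assms
proof (induction arbitrary: v' t' rule: run.induct)
  case (run_Var i E)
  then show ?case by (auto elim: run.cases)
next
  case (run_Const E m)
  then show ?case by (auto elim: run.cases)
next
  case (run_NullC E)
  then show ?case by (auto elim: run.cases)
next
  case (run_Op1 E p u s f v)
  from run_Op1.prems obtain u' s' where "run E p u' s'" "un_op f u' = Some v'" "t' = s' + 1"
    by (cases rule: run.cases) auto
  with run_Op1.IH[of u' s'] run_Op1.hyps show ?case by simp
next
  case (run_Op2 E p u s q w t f v)
  from run_Op2.prems obtain u' s' w' r' where "run E p u' s'" "run E q w' r'"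
    "bin_op f u' w' = Some v'" "t' = s' + r' + 1"
    by (cases rule: run.cases) auto
  with run_Op2.IH(1)[of u' s'] run_Op2.IH(2)[of w' r'] run_Op2.hyps show ?case by simp
next
  case (run_Ite_true E c x s p v t q)
  from run_Ite_true.prems show ?case
  proof (cases rule: run.cases)
    case T: (run_Ite_true y s' r')
    then show ?thesis using run_Ite_true.IH(1)[OF T(2)] run_Ite_true.IH(2)[OF T(4)] by simp
  next
    case F: (run_Ite_false s' r')
    then show ?thesis using run_Ite_true.IH(1)[OF F(2)] run_Ite_true.hyps by simp
  qed
next
  case (run_Ite_false E c s q v t p)
  from run_Ite_false.prems show ?case
  proof (cases rule: run.cases)
    case T: (run_Ite_true y s' r')
    then show ?thesis using run_Ite_false.IH(1)[OF T(2)] by simp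
  next
    case F: (run_Ite_false s' r')
    then show ?thesis using run_Ite_false.IH(1)[OF F(2)] run_Ite_false.IH(2)[OF F(3)] by simp
  qed
next
  case (run_Bind E p u s q v t)
  from run_Bind.prems obtain u' s' r' where "run E p u' s'" "run (u' # E) q v' r'" "t' = s' + r' + 1"
    by (cases rule: run.cases) auto
  with run_Bind.IH(1)[of u' s'] run_Bind.IH(2)[of v' r'] show ?case by simp
next
  case (run_While_stop u E c s b)
  from run_While_stop.prems show ?case
  proof (cases rule: run.cases)
    case S: (run_While_stop s')
    then show ?thesis using run_While_stop.IH[OF S(3)] by simp
  next
    case W: (run_While_step y r' w' s' t'')
    then show ?thesis using run_While_stop.IH[OF W(2)] by simp
  qed
next
  case (run_While_step u E c x r b w s v t)
  from run_While_step.prems show ?case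
  proof (cases rule: run.cases)
    case S: (run_While_stop s')
    then show ?thesis using run_While_step.IH(1)[OF S(3)] run_While_step.hyps by simp
  next
    case W: (run_While_step y r' w' s' t'')
    with run_While_step.IH(1)[of "Num y" r'] run_While_step.IH(2)[of w' s'] run_While_step.IH(3)[of v' t'']
    show ?thesis by simp
  qed
qed


section \<open>Constrained minimum sum of diameters clustering\<close>

text \<open>
  The points of an instance are \<open>0, ..., n - 1\<close>; the constraint is the set of its feasible
  partitions. \<open>side_info\<close> is whatever further input describes the constraint (e.g. colours).
\<close>

record msd_instance =
  num_points :: nat
  distance :: "nat \<Rightarrow> nat \<Rightarrow> real"
  side_info :: val
  feasible :: "nat set set set"

definition points :: "msd_instance \<Rightarrow> nat set" where
  "points I = {..<num_points I}"

definition diam :: "(nat \<Rightarrow> nat \<Rightarrow> real) \<Rightarrow> nat set \<Rightarrow> real" where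
  "diam d C = Max {d x y | x y. x \<in> C \<and> y \<in> C}"

definition cost :: "msd_instance \<Rightarrow> nat set set \<Rightarrow> real" where
  "cost I P = (\<Sum>C\<in>P. diam (distance I) C)"

definition valid_instance :: "msd_instance \<Rightarrow> bool" where
  "valid_instance I \<longleftrightarrow> num_points I \<ge> 1 \<and> Metric_space (points I) (distance I)
     \<and> (\<forall>P\<in>feasible I. partition_on (points I) P)"

definition mergeable :: "msd_instance \<Rightarrow> bool" where
  "mergeable I \<longleftrightarrow>
     (\<forall>P\<in>feasible I. \<forall>A\<in>P. \<forall>B\<in>P. A \<noteq> B \<longrightarrow> insert (A \<union> B) (P - {A, B}) \<in> feasible I)"

text \<open>A clustering problem is the set of its instances.\<close>

definition mergeable_msd_problem :: "msd_instance set \<Rightarrow> bool" where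
  "mergeable_msd_problem \<P> \<longleftrightarrow> (\<forall>I\<in>\<P>. valid_instance I \<and> mergeable I)"

definition feasible_solution :: "msd_instance \<Rightarrow> nat \<Rightarrow> nat set set \<Rightarrow> bool" where
  "feasible_solution I k P \<longleftrightarrow> P \<in> feasible I \<and> card P \<le> k"

definition optimal_solution :: "msd_instance \<Rightarrow> nat \<Rightarrow> nat set set \<Rightarrow> bool" where
  "optimal_solution I k P \<longleftrightarrow> feasible_solution I k P
     \<and> (\<forall>Q. feasible_solution I k Q \<longrightarrow> cost I P \<le> cost I Q)"


section \<open>Encodings and running times\<close>

fun list_val :: "val list \<Rightarrow> val" where
  "list_val [] = Null"
| "list_val (v # vs) = Cell v (list_val vs)"

definition nat_val :: "nat \<Rightarrow> val" where
  "nat_val m = Num (real m)"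

definition matrix_val :: "nat \<Rightarrow> (nat \<Rightarrow> nat \<Rightarrow> real) \<Rightarrow> val" where
  "matrix_val n d = list_val (map (\<lambda>i. list_val (map (\<lambda>j. Num (d i j)) [0..<n])) [0..<n])"

definition clusters_val :: "nat list list \<Rightarrow> val" where
  "clusters_val cs = list_val (map (\<lambda>c. list_val (map nat_val c)) cs)"

definition lists_partition :: "nat list list \<Rightarrow> nat set set \<Rightarrow> bool" where
  "lists_partition cs P \<longleftrightarrow> distinct (concat cs) \<and> [] \<notin> set cs \<and> set ` set cs = P"

definition instance_vals :: "msd_instance \<Rightarrow> val list" where
  "instance_vals I =
     [nat_val (num_points I), matrix_val (num_points I) (distance I), side_info I]"

text \<open>
  \<open>checks_feasibility p f \<P>\<close>: given an instance of \<open>\<P>\<close> with \<open>n\<close> points and any listing of a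
  partition of its points, \<open>p\<close> decides within \<open>f n\<close> steps whether the partition is feasible.
\<close>

definition checks_feasibility :: "prog \<Rightarrow> (nat \<Rightarrow> nat) \<Rightarrow> msd_instance set \<Rightarrow> bool" where
  "checks_feasibility p f \<P> \<longleftrightarrow>
     (\<forall>I\<in>\<P>. \<forall>P cs. partition_on (points I) P \<and> lists_partition cs P \<longrightarrow>
        (\<exists>t \<le> f (num_points I).
           run [list_val (instance_vals I @ [clusters_val cs])] p (truth (P \<in> feasible I)) t))"

text \<open>
  An exact algorithm returns a listing of an optimal solution, or \<open>Null\<close> (which lists no
  partition of a nonempty set) if there is no feasible solution.
\<close>

definition correct_output :: "msd_instance \<Rightarrow> nat \<Rightarrow> val \<Rightarrow> bool" where
  "correct_output I k v \<longleftrightarrow>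
     (if \<exists>P. feasible_solution I k P
      then \<exists>P cs. optimal_solution I k P \<and> lists_partition cs P \<and> v = clusters_val cs
      else v = Null)"

definition solves_within :: "prog \<Rightarrow> msd_instance \<Rightarrow> nat \<Rightarrow> nat \<Rightarrow> bool" where
  "solves_within p I k T \<longleftrightarrow>
     (\<exists>v t. run [list_val (instance_vals I @ [nat_val k])] p v t \<and> t \<le> T
        \<and> correct_output I k v)"


section \<open>Fair clustering\<close>

text \<open>
  Division by zero yields 0 here. If \<open>C\<close> misses one colour, the other quotient is 0, so the
  minimum is 0 just as if the quotient with denominator 0 were read as infinite.
\<close>

definition balanced :: "nat set \<Rightarrow> nat set \<Rightarrow> real \<Rightarrow> nat set \<Rightarrow> bool" where
  "balanced X1 X2 b C \<longleftrightarrow>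
     min (real (card (C \<inter> X2)) / real (card (C \<inter> X1)))
         (real (card (C \<inter> X1)) / real (card (C \<inter> X2))) \<ge> b"

definition fair_instance ::
    "nat \<Rightarrow> (nat \<Rightarrow> nat \<Rightarrow> real) \<Rightarrow> nat set \<Rightarrow> nat set \<Rightarrow> real \<Rightarrow> msd_instance" where
  "fair_instance n d X1 X2 b =
     \<lparr> num_points = n,
       distance = d,
       side_info = list_val [list_val (map (\<lambda>i. nat_val (if i \<in> X1 then 1 else 2)) [0..<n]), Num b],
       feasible = {P. partition_on {..<n} P \<and> (\<forall>C\<in>P. balanced X1 X2 b C)} \<rparr>"

definition fair_msd :: "msd_instance set" where
  "fair_msd = {fair_instance n d X1 X2 b | n d X1 X2 b.
     n \<ge> 1 \<and> Metric_space {..<n} d \<and> X1 \<union> X2 = {..<n} \<and> X1 \<inter> X2 = {} \<and> 0 \<le> b \<and> b \<le> 1}"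

end

theory Submission
  imports Defs
begin

text \<open>
  Among the optimal solutions take one with the fewest clusters. Merging any \<open>j \<ge> 2\<close> of its clusters
  is feasible and leaves fewer clusters, hence costs more, so the diameter of the union exceeds the sum
  of the diameters. If \<open>u\<close> is an endpoint of a diameter of the union, the distances from \<open>u\<close> to a
  single cluster span an interval no longer than its diameter, so these intervals leave a gap:
  some ball around \<open>u\<close> whose radius is the distance to a point separates the clusters into two groups.
  Repeating this, the solution arises from the trivial partition by at most \<open>k - 1\<close> ball splits, each
  one of \<open>n\<^sup>2\<close> choices. The program enumerates all \<open>n\<^bsup>2(k - 1)\<^esup>\<close> sequences of splits and returns a
  cheapest feasible result. A cluster is \<open>b\<close>-balanced iff two linear inequalities between its colour
  counts hold, so fairness is mergeable and can be checked in polynomial time.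
\<close>

section \<open>Time-bounded evaluation\<close>

text \<open>Partitions of \<open>n\<close> points into \<open>k\<close> clusters are exponentially
  many in \<open>n\<close>, so the search needs a description of an optimum by few numbers from a
  polynomial range. Ball splits supply it. A split is given by two points only: the centre also
  determines the cluster to be split, namely its own. The argument recurses into both parts of a
  split, so the diameter inequality is needed for every subfamily of at least two blocks, not just
  for the whole solution. It must be strict: if the sum of the diameters equalled the diameter of
  the union, touching intervals could still cover the whole range. Taking the fewest clusters among
  the optima yields strictness. Intermediate partitions are never tested for feasibility; the
  checker is called once per final candidate, hence the factor \<open>f n\<close>. To account for
  machine time, every loop is a fold over a list whose HOL counterpart specifies the
  program.\<close>

definition ev :: "val list \<Rightarrow> prog \<Rightarrow> val \<Rightarrow> nat \<Rightarrow> bool" where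
  "ev E p v T \<longleftrightarrow> (\<exists>t\<le>T. run E p v t)"

lemma ev_mono: "ev E p v T \<Longrightarrow> T \<le> T' \<Longrightarrow> ev E p v T'"
  unfolding ev_def by (meson le_trans)

text \<open>Applied first in every program verification: value and bound become schematic, the
  syntax-directed rules of \<open>ev_straight\<close> compute them, and only the two comparisons
  remain.\<close>

lemma ev_cong: "ev E p v T \<Longrightarrow> v = v' \<Longrightarrow> T \<le> T' \<Longrightarrow> ev E p v' T'"
  using ev_mono by blast

text \<open>Variables are de Bruijn indices, so entries added at the far end shift nothing. This
  allows the feasibility checker, specified in a one-entry environment, to be called below the
  bindings of the search loop.\<close>

lemma run_append: "run E p v t \<Longrightarrow> run (E @ F) p v t"
proof (induction rule: run.induct)
  case (run_Var i E)
  then show ?case using run.run_Var[of i "E @ F"] by (simp add: nth_append)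
next
  case (run_While_step u E c x r b w s v t)
  then show ?case using run.run_While_step[of u "E @ F"] by simp
qed (auto intro: run.intros[simplified])

lemma ev_append: "ev E p v T \<Longrightarrow> ev (E @ F) p v T"
  unfolding ev_def using run_append by blast

text \<open>Forces \<open>f n\<close> to be at least 1, so that the overhead of the search can be
  absorbed into a multiple of \<open>f n\<close>.\<close>

lemma run_time_pos: "run E p v t \<Longrightarrow> t \<ge> 1"
  by (induction rule: run.induct) auto

lemma ev_Var:
  "ev (a0 # E) (Var 0) a0 1"
  "ev (a0 # a1 # E) (Var 1) a1 1"
  "ev (a0 # a1 # a2 # E) (Var 2) a2 1"
  "ev (a0 # a1 # a2 # a3 # E) (Var 3) a3 1"
  "ev (a0 # a1 # a2 # a3 # a4 # E) (Var 4) a4 1"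
  "ev (a0 # a1 # a2 # a3 # a4 # a5 # E) (Var 5) a5 1"
  "ev (a0 # a1 # a2 # a3 # a4 # a5 # a6 # E) (Var 6) a6 1"
  "ev (a0 # a1 # a2 # a3 # a4 # a5 # a6 # a7 # E) (Var 7) a7 1"
  using run_Var[of 0 "a0 # E"] run_Var[of 1 "a0 # a1 # E"] run_Var[of 2 "a0 # a1 # a2 # E"]
    run_Var[of 3 "a0 # a1 # a2 # a3 # E"] run_Var[of 4 "a0 # a1 # a2 # a3 # a4 # E"]
    run_Var[of 5 "a0 # a1 # a2 # a3 # a4 # a5 # E"]
    run_Var[of 6 "a0 # a1 # a2 # a3 # a4 # a5 # a6 # E"]
    run_Var[of 7 "a0 # a1 # a2 # a3 # a4 # a5 # a6 # a7 # E"]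
  unfolding ev_def by auto

lemma ev_Const: "ev E (Const 0) (Num 0) 1" "ev E (Const 1) (Num 1) 1" "ev E (Const 2) (Num 2) 1"
  using run_Const[of E 0] run_Const[of E 1] run_Const[of E 2] unfolding ev_def by auto

lemma ev_NullC: "ev E NullC Null 1"
  unfolding ev_def using run_NullC by blast

lemma ev_Op1:
  assumes "ev E p u s" "un_op f u = Some v"
  shows "ev E (Op1 f p) v (s + 1)"
proof -
  from assms obtain s' where "s' \<le> s" "run E p u s'" unfolding ev_def by blast
  then show ?thesis unfolding ev_def using run_Op1[OF _ assms(2)] by (intro exI[of _ "s' + 1"]) auto
qed

lemma ev_Op2:
  assumes "ev E p u s" "ev E q w t" "bin_op f u w = Some v"
  shows "ev E (Op2 f p q) v (s + t + 1)"
proof -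
  from assms obtain s' t' where "s' \<le> s" "run E p u s'" "t' \<le> t" "run E q w t'"
    unfolding ev_def by blast
  then show ?thesis unfolding ev_def using run_Op2[OF _ _ assms(3)]
    by (intro exI[of _ "s' + t' + 1"]) auto
qed

lemma ev_Fst: "ev E p (Cell u v) s \<Longrightarrow> ev E (Op1 Fst p) u (s + 1)"
  and ev_Snd: "ev E p (Cell u v) s \<Longrightarrow> ev E (Op1 Snd p) v (s + 1)"
  and ev_IsNull: "ev E p w s \<Longrightarrow> ev E (Op1 IsNull p) (truth (w = Null)) (s + 1)"
  by (auto intro: ev_Op1[simplified])

lemma ev_arith:
  "ev E p (Num x) s \<Longrightarrow> ev E q (Num y) t \<Longrightarrow> ev E (Op2 Plus p q) (Num (x + y)) (s + t + 1)"
  "ev E p (Num x) s \<Longrightarrow> ev E q (Num y) t \<Longrightarrow> ev E (Op2 Minus p q) (Num (x - y)) (s + t + 1)"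
  "ev E p (Num x) s \<Longrightarrow> ev E q (Num y) t \<Longrightarrow> ev E (Op2 Times p q) (Num (x * y)) (s + t + 1)"
  "ev E p (Num x) s \<Longrightarrow> ev E q (Num y) t \<Longrightarrow> ev E (Op2 Less p q) (truth (x < y)) (s + t + 1)"
  by (auto intro: ev_Op2[simplified])

lemma ev_MkCell: "ev E p u s \<Longrightarrow> ev E q w t \<Longrightarrow> ev E (Op2 MkCell p q) (Cell u w) (s + t + 1)"
  by (auto intro: ev_Op2[simplified])

lemma ev_Bind:
  assumes "ev E p u s" "ev (u # E) q v t"
  shows "ev E (Bind p q) v (s + t + 1)"
proof -
  from assms obtain s' t' where "s' \<le> s" "run E p u s'" "t' \<le> t" "run (u # E) q v t'"
    unfolding ev_def by blast
  then show ?thesis unfolding ev_def by (intro exI[of _ "s' + t' + 1"]) (auto intro: run_Bind[simplified])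
qed

text \<open>The bound adds up both branches and the value stays a conditional, so symbolic execution
  continues without a case distinction.\<close>

lemma ev_Ite:
  assumes c: "ev E c (truth b) s" and "b \<Longrightarrow> ev E p v t" and "\<not> b \<Longrightarrow> ev E q w t'"
  shows "ev E (Ite c p q) (if b then v else w) (s + (t + t') + 1)"
proof (cases b)
  case True
  with assms obtain s' r where *: "s' \<le> s" "run E c (Num 1) s'" "r \<le> t" "run E p v r"
    unfolding ev_def truth_def by auto
  then have "run E (Ite c p q) v (s' + r + 1)" by (auto intro: run_Ite_true[simplified])
  with * True show ?thesis unfolding ev_def by (intro exI[of _ "s' + r + 1"]) auto
next
  case False
  with assms obtain s' r where *: "s' \<le> s" "run E c (Num 0) s'" "r \<le> t'" "run E q w r"
    unfolding ev_def truth_def by auto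
  then have "run E (Ite c p q) w (s' + r + 1)" by (auto intro: run_Ite_false[simplified])
  with * False show ?thesis unfolding ev_def by (intro exI[of _ "s' + r + 1"]) auto
qed

text \<open>For tests whose other branch would be stuck, such as taking \<open>Fst\<close> or
  \<open>Snd\<close> of \<open>Null\<close> in \<open>update_prog\<close> and
  \<open>output_prog\<close>.\<close>

lemma ev_Ite_True: "ev E c (truth b) s \<Longrightarrow> ev E p v t \<Longrightarrow> b \<Longrightarrow> ev E (Ite c p q) v (s + t + 1)"
  using ev_Ite[of E c b s p v t q v 0] by simp

lemma ev_While_stop: "ev (u # E) c (Num 0) s \<Longrightarrow> ev (u # E) (While c b) u (s + 1)"
  unfolding ev_def by (meson add_le_cancel_right run_While_stop)

lemma ev_While_step:
  assumes "ev (u # E) c (Num x) r" "x \<noteq> 0" "ev (u # E) b w s" "ev (w # E) (While c b) v t"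
  shows "ev (u # E) (While c b) v (r + s + t + 1)"
proof -
  from assms obtain r' s' t' where *: "r' \<le> r" "run (u # E) c (Num x) r'" "s' \<le> s"
    "run (u # E) b w s'" "t' \<le> t" "run (w # E) (While c b) v t'" unfolding ev_def by blast
  from run_While_step[OF *(2) assms(2) *(4) *(6)] * show ?thesis
    unfolding ev_def by (intro exI[of _ "r' + s' + t' + 1"]) auto
qed

lemmas ev_straight = ev_Var ev_Const ev_NullC ev_Fst ev_Snd ev_IsNull ev_arith ev_MkCell ev_Bind

text \<open>
  The state of the loop is the cell of the unprocessed list and the accumulator. The body \<open>b\<close> sees
  the accumulator as variable 0, the list element as variable 1 and the outer variable \<open>i\<close> as
  variable \<open>i + 3\<close>; variable 2 is the loop state.
\<close>

definition Fold :: "prog \<Rightarrow> prog \<Rightarrow> prog \<Rightarrow> prog" where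
  "Fold l i b = Bind (Op2 MkCell l i)
     (Op1 Snd (While (Op2 Less (Op1 IsNull (Op1 Fst (Var 0))) (Const 1))
       (Bind (Op1 Fst (Op1 Fst (Var 0))) (Bind (Op1 Snd (Var 1))
         (Op2 MkCell (Op1 Snd (Op1 Fst (Var 2))) b)))))"

text \<open>One iteration costs 5 for the emptiness test, \<open>Tb + 11\<close> for unpacking, body
  and repacking, and 1 for the loop step. The encodings \<open>ex\<close> and \<open>ea\<close> tie
  the machine loop to a HOL fold; \<open>Inv\<close> serves loops whose body has a time bound only
  for accumulators of controlled size.\<close>

lemma ev_Fold:
  assumes l: "ev E l (list_val (map ex xs)) T1"
    and i: "ev E i (ea a0) T2" and "Inv a0"
    and body: "\<And>x a st. x \<in> set xs \<Longrightarrow> Inv a \<Longrightarrow> ev (ea a # ex x # st # E) b (ea (g x a)) Tb"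
    and inv: "\<And>x a. x \<in> set xs \<Longrightarrow> Inv a \<Longrightarrow> Inv (g x a)"
  shows "ev E (Fold l i b) (ea (fold g xs a0)) (T1 + T2 + length xs * (Tb + 17) + 10)"
proof -
  define C where "C = Op2 Less (Op1 IsNull (Op1 Fst (Var 0))) (Const 1)"
  define B where "B = Bind (Op1 Fst (Op1 Fst (Var 0))) (Bind (Op1 Snd (Var 1))
         (Op2 MkCell (Op1 Snd (Op1 Fst (Var 2))) b))"
  have C: "ev (Cell w a # E) C (truth (w \<noteq> Null)) 5" for w a
  proof -
    have "ev (Cell w a # E) (Op1 IsNull (Op1 Fst (Var 0))) (Num (if w = Null then 1 else 0)) 3"
      by (rule ev_cong[OF ev_IsNull[OF ev_Fst[OF ev_Var(1)]]]) (simp_all add: truth_def)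
    from ev_arith(4)[OF this ev_Const(2)] show ?thesis
      unfolding C_def by (rule ev_cong) auto
  qed
  have loop: "ev (Cell (list_val (map ex ys)) (ea a) # E) (While C B) (Cell Null (ea (fold g ys a)))
        (length ys * (Tb + 17) + 6)" if "Inv a" "set ys \<subseteq> set xs" for ys a
    using that
  proof (induction ys arbitrary: a)
    case Nil
    have "ev (Cell Null (ea a) # E) C (Num 0) 5"
      using C[of Null "ea a"] by (simp add: truth_def)
    from ev_While_stop[OF this] show ?case by simp
  next
    case (Cons y ys)
    let ?u = "Cell (list_val (map ex (y # ys))) (ea a)"
    have "ev (?u # E) C (Num 1) 5"
      using C[of "list_val (map ex (y # ys))" "ea a"] by (simp add: truth_def)
    moreover have "ev (?u # E) B (Cell (list_val (map ex ys)) (ea (g y a))) (Tb + 11)"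
      unfolding B_def list.map list_val.simps
      by (rule ev_mono, rule ev_Bind[OF ev_Fst[OF ev_Fst[OF ev_Var(1)]]
            ev_Bind[OF ev_Snd[OF ev_Var(2)] ev_MkCell[OF ev_Snd[OF ev_Fst[OF ev_Var(3)]] body]]])
        (use Cons.prems in auto)
    moreover have "ev (Cell (list_val (map ex ys)) (ea (g y a)) # E) (While C B)
        (Cell Null (ea (fold g ys (g y a)))) (length ys * (Tb + 17) + 6)"
      using Cons.prems inv by (intro Cons.IH) auto
    ultimately have "ev (?u # E) (While C B) (Cell Null (ea (fold g ys (g y a))))
        (5 + (Tb + 11) + (length ys * (Tb + 17) + 6) + 1)"
      by (intro ev_While_step) auto
    then show ?case by (rule ev_cong) auto
  qed
  have "ev E (Bind (Op2 MkCell l i) (Op1 Snd (While C B))) (ea (fold g xs a0))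
     ((T1 + T2 + 1) + ((length xs * (Tb + 17) + 6) + 1) + 1)"
    by (intro ev_Bind[OF ev_MkCell[OF l i]] ev_Snd[OF loop]) (use \<open>Inv a0\<close> in auto)
  then show ?thesis unfolding Fold_def C_def B_def by (rule ev_mono) auto
qed

section \<open>The search program\<close>

text \<open>Turns the bound of \<open>ev_Fold\<close> back into a monomial: \<open>N\<close> bounds
  the iterations, \<open>X\<close> is the monomial of the body. Nested loops thus multiply powers of
  \<open>n\<close> while the constants only add up.\<close>

lemma fold_time:
  fixes l N T A X C B :: nat
  assumes "l \<le> N" "T + 17 \<le> A * X" "C + 10 \<le> B * (N * X)"
  shows "C + l * (T + 17) + 10 \<le> (A + B) * (N * X)"
proof -
  have "l * (T + 17) \<le> N * (A * X)" using assms by (intro mult_le_mono) auto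
  with assms show ?thesis by (simp add: algebra_simps)
qed

definition cluster_val :: "nat list \<Rightarrow> val" where
  "cluster_val c = list_val (map nat_val c)"

lemma clusters_val_eq: "clusters_val cs = list_val (map cluster_val cs)"
  unfolding clusters_val_def cluster_val_def ..

definition row_val :: "real list \<Rightarrow> val" where
  "row_val w = list_val (map Num w)"

definition rows_val :: "real list list \<Rightarrow> val" where
  "rows_val M = list_val (map row_val M)"

definition clusterings_val :: "nat list list list \<Rightarrow> val" where
  "clusterings_val L = list_val (map clusters_val L)"

lemma list_val_eq_Null: "list_val xs = Null \<longleftrightarrow> xs = []"
  by (cases xs) auto

text \<open>Variables: 0 is the index, 1 the list.\<close>

definition nth_prog :: prog where
  "nth_prog = Op1 Snd (Fold (Var 1) (Op2 MkCell (Var 0) NullC)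
     (Op2 MkCell (Op2 Minus (Op1 Fst (Var 0)) (Const 1))
       (Ite (Op2 Less (Op1 Fst (Var 0)) (Const 0)) (Op1 Snd (Var 0)) (Var 1))))"

text \<open>A fold cannot stop early. The result is overwritten until the counter turns negative, so
  the last overwriting happens at counter 0, which is position \<open>x\<close>.\<close>

lemma fold_countdown:
  assumes "x < length vs"
  defines "g \<equiv> \<lambda>e (i :: real, res). (i - 1, if i < 0 then res else e)"
  shows "snd (fold g vs (real x, res)) = vs ! x"
  using assms(1)
proof (induction vs arbitrary: x res)
  case (Cons v vs)
  have neg: "i < 0 \<Longrightarrow> snd (fold g vs (i, res)) = res" for i :: real and vs res
    by (induction vs arbitrary: i) (auto simp: g_def)
  show ?case
  proof (cases x)
    case 0
    have "g v (real x, res) = (real x - 1, v)" using 0 by (simp add: g_def)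
    then show ?thesis using 0 neg[of "-1" vs v] by simp
  next
    case (Suc y)
    then have "g v (real x, res) = (real y, v)" by (simp add: g_def)
    then have "fold g (v # vs) (real x, res) = fold g vs (real y, v)" by (simp only: fold_simps)
    then show ?thesis using Suc Cons.IH[of y v] Cons.prems by simp
  qed
qed simp

lemma ev_nth:
  assumes "x < length vs"
  shows "ev (Num (real x) # list_val vs # E) nth_prog (vs ! x) (45 * length vs)"
proof -
  define ea :: "real \<times> val \<Rightarrow> val" where "ea = (\<lambda>(i, res). Cell (Num i) res)"
  define g :: "val \<Rightarrow> real \<times> val \<Rightarrow> real \<times> val"
    where "g = (\<lambda>e (i, res). (i - 1, if i < 0 then res else e))"
  have "ev (Num (real x) # list_val vs # E) (Fold (Var 1) (Op2 MkCell (Var 0) NullC)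
     (Op2 MkCell (Op2 Minus (Op1 Fst (Var 0)) (Const 1))
       (Ite (Op2 Less (Op1 Fst (Var 0)) (Const 0)) (Op1 Snd (Var 0)) (Var 1))))
     (ea (fold g vs (real x, Null))) (1 + 3 + length vs * (13 + 17) + 10)"
  proof (rule ev_Fold[where ex = "\<lambda>v. v" and Inv = "\<lambda>_. True"])
    show "ev (Num (real x) # list_val vs # E) (Var 1) (list_val (map (\<lambda>v. v) vs)) 1"
      by (simp add: ev_Var[simplified])
    show "ev (Num (real x) # list_val vs # E) (Op2 MkCell (Var 0) NullC) (ea (real x, Null)) 3"
      unfolding ea_def by (rule ev_cong, (rule ev_straight)+) auto
    fix v st and a :: "real \<times> val"
    obtain i res where a: "a = (i, res)" by (cases a)
    show "ev (ea a # v # st # Num (real x) # list_val vs # E)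
       (Op2 MkCell (Op2 Minus (Op1 Fst (Var 0)) (Const 1))
       (Ite (Op2 Less (Op1 Fst (Var 0)) (Const 0)) (Op1 Snd (Var 0)) (Var 1))) (ea (g v a)) 13"
      unfolding a ea_def g_def prod.case
      by (rule ev_cong, (rule ev_straight ev_Ite)+) auto
  qed auto
  then have "ev (Num (real x) # list_val vs # E) (Fold (Var 1) (Op2 MkCell (Var 0) NullC)
     (Op2 MkCell (Op2 Minus (Op1 Fst (Var 0)) (Const 1))
       (Ite (Op2 Less (Op1 Fst (Var 0)) (Const 0)) (Op1 Snd (Var 0)) (Var 1))))
     (Cell (Num (fst (fold g vs (real x, Null)))) (snd (fold g vs (real x, Null))))
     (30 * length vs + 14)"
    by (rule ev_cong) (auto simp: ea_def split_beta)
  from ev_Snd[OF this] have "ev (Num (real x) # list_val vs # E) nth_prog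
     (snd (fold g vs (real x, Null))) (30 * length vs + 14 + 1)"
    unfolding nth_prog_def .
  moreover have "snd (fold g vs (real x, Null)) = vs ! x"
    unfolding g_def by (rule fold_countdown[OF assms])
  moreover have "30 * length vs + 14 + 1 \<le> 45 * length vs" using assms by linarith
  ultimately show ?thesis using ev_mono by simp
qed

lemma ev_nth_row:
  assumes "x < length w"
  shows "ev (nat_val x # row_val w # E) nth_prog (Num (w ! x)) (45 * length w)"
  using ev_nth[of x "map Num w" E] assms by (simp add: row_val_def nat_val_def)

lemma ev_nth_rows:
  assumes "x < length M"
  shows "ev (nat_val x # rows_val M # E) nth_prog (row_val (M ! x)) (45 * length M)"
  using ev_nth[of x "map row_val M" E] assms by (simp add: rows_val_def nat_val_def)

text \<open>
  Variables: 0 is a radius \<open>r\<close>, 1 the row of distances from a point \<open>u\<close>, 2 a cluster. Returns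
  whether \<open>u\<close> lies in the cluster (recognized by distance 0), and the parts of the cluster inside
  and outside the ball of radius \<open>r\<close> around \<open>u\<close>.
\<close>

definition parts_prog :: prog where
  "parts_prog = Fold (Var 2) (Op2 MkCell (Const 0) (Op2 MkCell NullC NullC))
     (Bind (Bind (Var 4) (Bind (Var 2) nth_prog))
       (Op2 MkCell (Ite (Op2 Less (Const 0) (Var 0)) (Op1 Fst (Var 1)) (Const 1))
         (Ite (Op2 Less (Var 4) (Var 0))
           (Op2 MkCell (Op1 Fst (Op1 Snd (Var 1))) (Op2 MkCell (Var 2) (Op1 Snd (Op1 Snd (Var 1)))))
           (Op2 MkCell (Op2 MkCell (Var 2) (Op1 Fst (Op1 Snd (Var 1)))) (Op1 Snd (Op1 Snd (Var 1)))))))"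

lemma ev_parts:
  assumes c: "length c \<le> n" "\<forall>x\<in>set c. x < n" and n: "length w = n" "1 \<le> n"
  shows "ev (Num r # row_val w # cluster_val c # E) parts_prog
     (Cell (truth (\<exists>x\<in>set c. \<not> 0 < w ! x))
       (Cell (cluster_val (rev [x\<leftarrow>c. \<not> r < w ! x])) (cluster_val (rev [x\<leftarrow>c. r < w ! x]))))
     (120 * n ^ 2)"
proof -
  define ea :: "bool \<times> nat list \<times> nat list \<Rightarrow> val"
    where "ea = (\<lambda>(b, i, j). Cell (truth b) (Cell (cluster_val i) (cluster_val j)))"
  define g :: "nat \<Rightarrow> bool \<times> nat list \<times> nat list \<Rightarrow> bool \<times> nat list \<times> nat list"
    where "g = (\<lambda>x (b, i, j). (if 0 < w ! x then b else True,
       if r < w ! x then i else x # i, if r < w ! x then x # j else j))"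
  have "fold g c (b, i, j) = (b \<or> (\<exists>x\<in>set c. \<not> 0 < w ! x),
      rev [x\<leftarrow>c. \<not> r < w ! x] @ i, rev [x\<leftarrow>c. r < w ! x] @ j)" for b i j
    by (induction c arbitrary: b i j) (auto simp: g_def)
  then have fold: "fold g c (False, [], []) = (\<exists>x\<in>set c. \<not> 0 < w ! x,
      rev [x\<leftarrow>c. \<not> r < w ! x], rev [x\<leftarrow>c. r < w ! x])" by simp
  have "ev (Num r # row_val w # cluster_val c # E) parts_prog (ea (fold g c (False, [], [])))
     (1 + 5 + length c * ((45 * n + 35) + 17) + 10)"
    unfolding parts_prog_def
  proof (rule ev_Fold[where ex = nat_val and Inv = "\<lambda>_. True"])
    show "ev (Num r # row_val w # cluster_val c # E) (Var 2) (list_val (map nat_val c)) 1"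
      unfolding cluster_val_def by (rule ev_Var)
    show "ev (Num r # row_val w # cluster_val c # E)
      (Op2 MkCell (Const 0) (Op2 MkCell NullC NullC)) (ea (False, [], [])) 5"
      unfolding ea_def by (rule ev_cong, (rule ev_straight)+) (auto simp: truth_def cluster_val_def)
    fix x st and a :: "bool \<times> nat list \<times> nat list" assume "x \<in> set c"
    then have xw: "x < length w" using c n by auto
    obtain b i j where a: "a = (b, i, j)" by (cases a)
    show "ev (ea a # nat_val x # st # Num r # row_val w # cluster_val c # E)
     (Bind (Bind (Var 4) (Bind (Var 2) nth_prog))
       (Op2 MkCell (Ite (Op2 Less (Const 0) (Var 0)) (Op1 Fst (Var 1)) (Const 1))
         (Ite (Op2 Less (Var 4) (Var 0))
           (Op2 MkCell (Op1 Fst (Op1 Snd (Var 1))) (Op2 MkCell (Var 2) (Op1 Snd (Op1 Snd (Var 1)))))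
           (Op2 MkCell (Op2 MkCell (Var 2) (Op1 Fst (Op1 Snd (Var 1)))) (Op1 Snd (Op1 Snd (Var 1)))))))
      (ea (g x a)) (45 * n + 35)"
      unfolding a ea_def g_def prod.case
      by (rule ev_cong, (rule ev_straight ev_Ite ev_nth_row[OF xw])+)
        (use n in \<open>auto simp: cluster_val_def truth_def\<close>)
  qed auto
  then show ?thesis
  proof (rule ev_cong)
    have "1 + 5 + length c * ((45 * n + 35) + 17) + 10 \<le> (97 + 16) * (n * n)"
      using c n by (intro fold_time) auto
    then show "1 + 5 + length c * ((45 * n + 35) + 17) + 10 \<le> 120 * n ^ 2"
      by (simp add: power2_eq_square)
  qed (simp add: fold ea_def)
qed

section \<open>Listed clusterings and their refinement by one ball\<close>

definition clustering :: "nat \<Rightarrow> nat list list \<Rightarrow> bool" where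
  "clustering n cs \<longleftrightarrow> distinct (concat cs) \<and> [] \<notin> set cs \<and> set (concat cs) = {..<n}"

lemma clustering_length:
  assumes "clustering n cs"
  shows "length cs \<le> n"
proof -
  have "[] \<notin> set cs \<Longrightarrow> length cs \<le> length (concat cs)"
  proof (induction cs)
    case (Cons c cs)
    then have "1 \<le> length c" by (cases c) auto
    with Cons show ?case by simp
  qed simp
  moreover have "length (concat cs) = card {..<n}"
    using assms distinct_card[of "concat cs"] unfolding clustering_def by simp
  ultimately show ?thesis using assms unfolding clustering_def by simp
qed

lemma distinct_concat_member: "distinct (concat cs) \<Longrightarrow> c \<in> set cs \<Longrightarrow> distinct c"
  by (induction cs) auto

lemma clustering_member:
  assumes "clustering n cs" "c \<in> set cs"
  shows "\<forall>x\<in>set c. x < n" "length c \<le> n"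
proof -
  show lt: "\<forall>x\<in>set c. x < n" using assms unfolding clustering_def by auto
  have "distinct c" using assms distinct_concat_member unfolding clustering_def by blast
  then have "length c = card (set c)" by (simp add: distinct_card)
  also have "\<dots> \<le> card {..<n}" using lt by (intro card_mono) auto
  finally show "length c \<le> n" by simp
qed

text \<open>If \<open>w\<close> is the row of distances from \<open>u\<close>, its only entry that
  is not positive is the one at \<open>u\<close>, so the first condition says that \<open>u\<close>
  lies in \<open>c\<close>. The second keeps the outer part nonempty. The reversals mirror the order
  in which the program conses.\<close>

definition split_cluster :: "real list \<Rightarrow> real \<Rightarrow> nat list \<Rightarrow> nat list list" where
  "split_cluster w r c =
     (if (\<exists>x\<in>set c. \<not> 0 < w ! x) \<and> (\<exists>x\<in>set c. r < w ! x)
      then [rev [x\<leftarrow>c. \<not> r < w ! x], rev [x\<leftarrow>c. r < w ! x]] else [c])"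

text \<open>The tail comes first because the program's fold prepends the pieces of each cluster to
  the accumulator.\<close>

fun split_all :: "real list \<Rightarrow> real \<Rightarrow> nat list list \<Rightarrow> nat list list" where
  "split_all w r [] = []"
| "split_all w r (c # cs) = split_all w r cs @ split_cluster w r c"

lemma fold_split: "fold (\<lambda>c A. split_cluster w r c @ A) cs A = split_all w r cs @ A"
  by (induction cs arbitrary: A) auto

lemma set_split: "set (split_all w r cs) = (\<Union>c\<in>set cs. set (split_cluster w r c))"
  by (induction cs) auto

lemma set_concat_split: "set (concat (split_all w r cs)) = set (concat cs)"
proof -
  have "set (concat (split_cluster w r c)) = set c" for c
    unfolding split_cluster_def by auto
  then show ?thesis by (induction cs) auto
qed

text \<open>With \<open>0 \<le> r\<close> a point whose entry is not positive stays in the inner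
  part, and a split is made only if some point lies outside; hence neither part is empty.\<close>

lemma clustering_split:
  assumes "clustering n cs" "0 \<le> r"
  shows "clustering n (split_all w r cs)"
proof -
  have sub: "set (concat (split_cluster w r c)) = set c" for c
    unfolding split_cluster_def by auto
  have d: "distinct (concat (split_cluster w r c))" if "distinct c" for c
    using that unfolding split_cluster_def by auto
  have "distinct (concat cs) \<Longrightarrow> distinct (concat (split_all w r cs))"
  proof (induction cs)
    case (Cons c cs)
    then show ?case using sub[of c] d[of c] set_concat_split[of w r cs] by simp blast
  qed simp
  moreover have "[] \<notin> set (split_cluster w r c)" if "c \<noteq> []" for c
    using that \<open>0 \<le> r\<close> unfolding split_cluster_def
    by (auto simp: filter_empty_conv) (meson le_less_trans linorder_not_le)
  ultimately show ?thesis using assms unfolding clustering_def set_concat_split set_split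
    by auto metis
qed

text \<open>Variables as in \<open>parts_prog\<close>, with a clustering instead of the cluster.\<close>

definition split_prog :: prog where
  "split_prog = Fold (Var 2) NullC
     (Bind (Bind (Var 1) (Bind (Var 5) (Bind (Var 5) parts_prog)))
       (Ite (Op1 Fst (Var 0))
         (Ite (Op1 IsNull (Op1 Snd (Op1 Snd (Var 0)))) (Op2 MkCell (Var 2) (Var 1))
           (Op2 MkCell (Op1 Fst (Op1 Snd (Var 0))) (Op2 MkCell (Op1 Snd (Op1 Snd (Var 0))) (Var 1))))
         (Op2 MkCell (Var 2) (Var 1))))"

lemma ev_split:
  assumes cs: "clustering n cs" and n: "length w = n" "1 \<le> n"
  shows "ev (Num r # row_val w # clusters_val cs # E) split_prog (clusters_val (split_all w r cs))
     (200 * n ^ 3)"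
proof -
  define g :: "nat list \<Rightarrow> nat list list \<Rightarrow> nat list list"
    where "g = (\<lambda>c A. split_cluster w r c @ A)"
  have "ev (Num r # row_val w # clusters_val cs # E) split_prog (clusters_val (fold g cs []))
     (1 + 1 + length cs * ((120 * n ^ 2 + 40) + 17) + 10)"
    unfolding split_prog_def
  proof (rule ev_Fold[where ex = cluster_val and Inv = "\<lambda>_. True"])
    show "ev (Num r # row_val w # clusters_val cs # E) (Var 2) (list_val (map cluster_val cs)) 1"
      unfolding clusters_val_eq by (rule ev_Var)
    show "ev (Num r # row_val w # clusters_val cs # E) NullC (clusters_val []) 1"
      unfolding clusters_val_def by (rule ev_cong, rule ev_NullC) auto
    fix c A st assume "c \<in> set cs"
    then have c: "length c \<le> n" "\<forall>x\<in>set c. x < n" using clustering_member[OF cs] by auto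
    show "ev (clusters_val A # cluster_val c # st # Num r # row_val w # clusters_val cs # E)
       (Bind (Bind (Var 1) (Bind (Var 5) (Bind (Var 5) parts_prog)))
       (Ite (Op1 Fst (Var 0))
         (Ite (Op1 IsNull (Op1 Snd (Op1 Snd (Var 0)))) (Op2 MkCell (Var 2) (Var 1))
           (Op2 MkCell (Op1 Fst (Op1 Snd (Var 0))) (Op2 MkCell (Op1 Snd (Op1 Snd (Var 0))) (Var 1))))
         (Op2 MkCell (Var 2) (Var 1)))) (clusters_val (g c A)) (120 * n ^ 2 + 40)"
      by (rule ev_cong, (rule ev_straight ev_Ite ev_parts[OF c n])+)
        (auto simp: g_def split_cluster_def clusters_val_eq cluster_val_def list_val_eq_Null
          filter_empty_conv)
  qed auto
  then show ?thesis
  proof (rule ev_cong)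
    have "1 + 1 + length cs * ((120 * n ^ 2 + 40) + 17) + 10 \<le> (177 + 12) * (n * n ^ 2)"
      using clustering_length[OF cs] n by (intro fold_time) auto
    then show "1 + 1 + length cs * ((120 * n ^ 2 + 40) + 17) + 10 \<le> 200 * n ^ 3"
      by (simp add: power2_eq_square power3_eq_cube)
  qed (use fold_split[of w r cs "[]"] in \<open>simp add: g_def\<close>)
qed

section \<open>One round of splits over all centres and radii\<close>

definition expand :: "real list list \<Rightarrow> nat list list list \<Rightarrow> nat list list list" where
  "expand M L = fold (\<lambda>cs A. fold (\<lambda>w A. fold (\<lambda>r A. split_all w r cs # A) w A) M A) L []"

lemma set_expand: "set (expand M L) = {split_all w r cs | cs w r. cs \<in> set L \<and> w \<in> set M \<and> r \<in> set w}"
proof -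
  have 1: "set (fold (\<lambda>r A. split_all w r cs # A) rs A) = (\<lambda>r. split_all w r cs) ` set rs \<union> set A"
    for w cs rs A by (induction rs arbitrary: A) auto
  have 2: "set (fold (\<lambda>w A. fold (\<lambda>r A. split_all w r cs # A) w A) M A)
      = (\<Union>w\<in>set M. (\<lambda>r. split_all w r cs) ` set w) \<union> set A" for cs A
    by (induction M arbitrary: A) (auto simp: 1)
  have "set (fold (\<lambda>cs A. fold (\<lambda>w A. fold (\<lambda>r A. split_all w r cs # A) w A) M A) L A)
      = (\<Union>cs\<in>set L. \<Union>w\<in>set M. (\<lambda>r. split_all w r cs) ` set w) \<union> set A" for A
    by (induction L arbitrary: A) (auto simp: 2)
  then show ?thesis unfolding expand_def by auto
qed

text \<open>Duplicates and ineffective splits are kept, which makes the count an equality and the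
  growth per round exact.\<close>

lemma length_expand:
  assumes "length M = n" "\<forall>w\<in>set M. length w = n"
  shows "length (expand M L) = length L * n ^ 2"
proof -
  have 1: "length (fold (\<lambda>r A. split_all w r cs # A) rs A) = length rs + length A" for w cs rs A
    by (induction rs arbitrary: A) auto
  have "\<forall>w\<in>set M. length w = n \<Longrightarrow>
      length (fold (\<lambda>w A. fold (\<lambda>r A. split_all w r cs # A) w A) M A) = length M * n + length A" for cs A
    by (induction M arbitrary: A) (auto simp: 1)
  then have 2: "length (fold (\<lambda>w A. fold (\<lambda>r A. split_all w r cs # A) w A) M A) = n * n + length A" for cs A
    using assms by simp
  have "length (fold (\<lambda>cs A. fold (\<lambda>w A. fold (\<lambda>r A. split_all w r cs # A) w A) M A) L A)
      = length L * n ^ 2 + length A" for A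
    by (induction L arbitrary: A) (auto simp: 2 power2_eq_square)
  then show ?thesis unfolding expand_def by simp
qed

text \<open>Variables: 0 is a list of clusterings, 1 the distance matrix.\<close>

definition expand_prog :: prog where
  "expand_prog = Fold (Var 0) NullC (Fold (Var 4) (Var 0) (Fold (Var 1) (Var 0)
     (Op2 MkCell (Bind (Var 7) (Bind (Var 5) (Bind (Var 3) split_prog))) (Var 0))))"

lemma ev_expand:
  assumes L: "\<forall>cs\<in>set L. clustering n cs" "length L \<le> N" "1 \<le> N"
    and M: "length M = n" "\<forall>w\<in>set M. length w = n" and n: "1 \<le> n"
  shows "ev (clusterings_val L # rows_val M # E) expand_prog (clusterings_val (expand M L))
     (400 * (N * n ^ 5))"
proof -
  have 1: "ev (clusterings_val A # row_val w # s1 # A' # clusters_val cs # E')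
     (Fold (Var 1) (Var 0) (Op2 MkCell (Bind (Var 7) (Bind (Var 5) (Bind (Var 3) split_prog))) (Var 0)))
     (clusterings_val (fold (\<lambda>r A. split_all w r cs # A) w A)) (239 * n ^ 4)"
    if cs: "clustering n cs" and w: "w \<in> set M" for A w s1 A' cs E'
  proof -
    have lw: "length w = n" using w M by simp
    have "ev (clusterings_val A # row_val w # s1 # A' # clusters_val cs # E')
      (Fold (Var 1) (Var 0) (Op2 MkCell (Bind (Var 7) (Bind (Var 5) (Bind (Var 3) split_prog))) (Var 0)))
      (clusterings_val (fold (\<lambda>r A. split_all w r cs # A) w A)) (1 + 1 + length w * ((200 * n ^ 3 + 8) + 17) + 10)"
    proof (rule ev_Fold[where ex = Num and Inv = "\<lambda>_. True"])
      show "ev (clusterings_val A # row_val w # s1 # A' # clusters_val cs # E') (Var 1)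
         (list_val (map Num w)) 1"
        unfolding row_val_def by (rule ev_Var)
      fix r A2 s2
      show "ev (clusterings_val A2 # Num r # s2 # clusterings_val A # row_val w # s1 # A' # clusters_val cs # E')
        (Op2 MkCell (Bind (Var 7) (Bind (Var 5) (Bind (Var 3) split_prog))) (Var 0))
        (clusterings_val (split_all w r cs # A2)) (200 * n ^ 3 + 8)"
        by (rule ev_cong, (rule ev_straight ev_split[OF cs lw n])+) (auto simp: clusterings_val_def)
    qed (rule ev_Var TrueI)+
    then show ?thesis
    proof (rule ev_mono)
      have "1 + 1 + length w * ((200 * n ^ 3 + 8) + 17) + 10 \<le> (225 + 12) * (n * n ^ 3)"
        using lw n by (intro fold_time) auto
      then show "1 + 1 + length w * ((200 * n ^ 3 + 8) + 17) + 10 \<le> 239 * n ^ 4"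
        by (simp flip: power_Suc)
    qed
  qed
  have 2: "ev (clusterings_val A # clusters_val cs # s # x # rows_val M # E')
     (Fold (Var 4) (Var 0) (Fold (Var 1) (Var 0)
        (Op2 MkCell (Bind (Var 7) (Bind (Var 5) (Bind (Var 3) split_prog))) (Var 0))))
     (clusterings_val (fold (\<lambda>w A. fold (\<lambda>r A. split_all w r cs # A) w A) M A)) (270 * n ^ 5)"
    if cs: "clustering n cs" for A cs s x E'
  proof -
    have "ev (clusterings_val A # clusters_val cs # s # x # rows_val M # E')
     (Fold (Var 4) (Var 0) (Fold (Var 1) (Var 0)
        (Op2 MkCell (Bind (Var 7) (Bind (Var 5) (Bind (Var 3) split_prog))) (Var 0))))
     (clusterings_val (fold (\<lambda>w A. fold (\<lambda>r A. split_all w r cs # A) w A) M A))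
      (1 + 1 + length M * (239 * n ^ 4 + 17) + 10)"
    proof (rule ev_Fold[where ex = row_val and Inv = "\<lambda>_. True"])
      show "ev (clusterings_val A # clusters_val cs # s # x # rows_val M # E') (Var 4)
         (list_val (map row_val M)) 1"
        unfolding rows_val_def by (rule ev_Var)
    qed (rule ev_Var TrueI 1[OF cs] | assumption)+
    then show ?thesis
    proof (rule ev_mono)
      have "1 + 1 + length M * (239 * n ^ 4 + 17) + 10 \<le> (256 + 12) * (n * n ^ 4)"
        using M n by (intro fold_time) auto
      then show "1 + 1 + length M * (239 * n ^ 4 + 17) + 10 \<le> 270 * n ^ 5"
        by (simp flip: power_Suc)
    qed
  qed
  have "ev (clusterings_val L # rows_val M # E) expand_prog (clusterings_val (expand M L))
     (1 + 1 + length L * (270 * n ^ 5 + 17) + 10)"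
    unfolding expand_prog_def expand_def
  proof (rule ev_Fold[where ex = clusters_val and Inv = "\<lambda>_. True"])
    show "ev (clusterings_val L # rows_val M # E) (Var 0) (list_val (map clusters_val L)) 1"
      unfolding clusterings_val_def by (rule ev_Var)
    show "ev (clusterings_val L # rows_val M # E) NullC (clusterings_val []) 1"
      unfolding clusterings_val_def by (rule ev_cong, rule ev_NullC) auto
  qed (rule TrueI | rule 2 | use L in blast)+
  then show ?thesis
  proof (rule ev_mono)
    have "1 \<le> N * n ^ 5" using n L by auto
    then have "1 + 1 + length L * (270 * n ^ 5 + 17) + 10 \<le> (287 + 12) * (N * n ^ 5)"
      using L n by (intro fold_time) auto
    then show "1 + 1 + length L * (270 * n ^ 5 + 17) + 10 \<le> 400 * (N * n ^ 5)" by simp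
  qed
qed

text \<open>Variable 0 is the distance matrix, used only to count to \<open>n\<close>.\<close>

definition points_prog :: prog where
  "points_prog = Op1 Snd (Fold (Var 0) (Op2 MkCell (Const 0) NullC)
     (Op2 MkCell (Op2 Plus (Op1 Fst (Var 0)) (Const 1))
       (Op2 MkCell (Op1 Fst (Var 0)) (Op1 Snd (Var 0)))))"

lemma ev_points:
  assumes M: "length M = n" and n: "1 \<le> n"
  shows "ev (rows_val M # E) points_prog (cluster_val (rev [0..<n])) (50 * n)"
proof -
  define ea :: "nat \<times> nat list \<Rightarrow> val" where "ea = (\<lambda>(i, xs). Cell (nat_val i) (cluster_val xs))"
  define g :: "real list \<Rightarrow> nat \<times> nat list \<Rightarrow> nat \<times> nat list" where "g = (\<lambda>w (i, xs). (i + 1, i # xs))"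
  have "fold g rs (i, rev [0..<i]) = (i + length rs, rev [0..<i + length rs])" for rs i
  proof (induction rs arbitrary: i)
    case (Cons w rs)
    have "g w (i, rev [0..<i]) = (Suc i, rev [0..<Suc i])" by (simp add: g_def)
    then show ?case using Cons[of "Suc i"] by (simp only: fold_simps) simp
  qed simp
  from this[of M 0] have fold: "fold g M (0, []) = (n, rev [0..<n])" using M by simp
  have "ev (rows_val M # E) (Fold (Var 0) (Op2 MkCell (Const 0) NullC)
     (Op2 MkCell (Op2 Plus (Op1 Fst (Var 0)) (Const 1))
       (Op2 MkCell (Op1 Fst (Var 0)) (Op1 Snd (Var 0))))) (ea (fold g M (0, [])))
      (1 + 3 + length M * (10 + 17) + 10)"
  proof (rule ev_Fold[where ex = row_val and Inv = "\<lambda>_. True"])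
    show "ev (rows_val M # E) (Var 0) (list_val (map row_val M)) 1"
      unfolding rows_val_def by (rule ev_Var)
    show "ev (rows_val M # E) (Op2 MkCell (Const 0) NullC) (ea (0, [])) 3"
      unfolding ea_def by (rule ev_cong, (rule ev_straight)+) (auto simp: nat_val_def cluster_val_def)
    fix w st and a :: "nat \<times> nat list"
    obtain i xs where a: "a = (i, xs)" by (cases a)
    show "ev (ea a # row_val w # st # rows_val M # E)
      (Op2 MkCell (Op2 Plus (Op1 Fst (Var 0)) (Const 1))
       (Op2 MkCell (Op1 Fst (Var 0)) (Op1 Snd (Var 0)))) (ea (g w a)) 10"
      unfolding a ea_def g_def prod.case nat_val_def cluster_val_def
      by (rule ev_cong, (rule ev_straight)+) (auto simp: nat_val_def)
  qed (rule TrueI)+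
  then have "ev (rows_val M # E) (Fold (Var 0) (Op2 MkCell (Const 0) NullC)
     (Op2 MkCell (Op2 Plus (Op1 Fst (Var 0)) (Const 1))
       (Op2 MkCell (Op1 Fst (Var 0)) (Op1 Snd (Var 0)))))
      (Cell (nat_val n) (cluster_val (rev [0..<n]))) (1 + 3 + length M * (10 + 17) + 10)"
    by (simp add: fold ea_def)
  from ev_Snd[OF this] show ?thesis unfolding points_prog_def
    by (rule ev_mono) (use M n in simp)
qed

text \<open>
  Here \<open>k - 1\<close> is the number of remaining rounds. Folding over the \<open>n\<close> rows caps it at \<open>n\<close>, as the
  running time must not depend on \<open>k\<close> if \<open>n = 1\<close>.
\<close>

definition level :: "real list list \<Rightarrow> real list \<Rightarrow> nat \<times> nat list list list \<Rightarrow> nat \<times> nat list list list" where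
  "level M w = (\<lambda>(k, L). if 1 < k then (k - 1, expand M L) else (k, L))"

definition candidates :: "real list list \<Rightarrow> nat \<Rightarrow> nat list list list" where
  "candidates M k = snd (fold (level M) M (k, [[rev [0..<length M]]]))"

text \<open>The entries also serve as radii, and \<open>clustering_split\<close> wants these
  nonnegative.\<close>

definition good_matrix :: "nat \<Rightarrow> real list list \<Rightarrow> bool" where
  "good_matrix n M \<longleftrightarrow> length M = n \<and> (\<forall>w\<in>set M. length w = n \<and> (\<forall>r\<in>set w. 0 \<le> r))"

text \<open>A conserved product: an effective round multiplies the number of clusterings by
  \<open>n ^ 2\<close> and takes the same factor from the growth still to come. It bounds the list
  at every round, not only at the end.\<close>

definition level_inv :: "nat \<Rightarrow> nat \<Rightarrow> nat \<times> nat list list list \<Rightarrow> bool" where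
  "level_inv n k0 = (\<lambda>(k, L). 1 \<le> k \<and> k \<le> k0 \<and> (\<forall>cs\<in>set L. clustering n cs) \<and>
     length L * n ^ (2 * (k - 1)) = n ^ (2 * (k0 - 1)))"

lemma level_inv_level:
  assumes M: "good_matrix n M" and inv: "level_inv n k0 a"
  shows "level_inv n k0 (level M w a)"
proof -
  obtain k L where a: "a = (k, L)" by (cases a)
  show ?thesis
  proof (cases "1 < k")
    case True
    then have "2 * (k - 1) = 2 + 2 * (k - 1 - 1)" by simp
    then have "n ^ (2 * (k - 1)) = n ^ 2 * n ^ (2 * (k - 1 - 1))" by (metis power_add)
    moreover have "length (expand M L) = length L * n ^ 2"
      using M unfolding good_matrix_def by (intro length_expand) auto
    moreover have "\<forall>cs\<in>set (expand M L). clustering n cs"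
      using M inv a unfolding good_matrix_def level_inv_def set_expand
      by (auto intro: clustering_split)
    ultimately show ?thesis using inv True unfolding level_inv_def a level_def
      by (auto simp: mult.assoc)
  qed (use inv a in \<open>auto simp: level_def level_inv_def\<close>)
qed

lemma level_inv_init:
  assumes "1 \<le> n" "1 \<le> k"
  shows "level_inv n k (k, [[rev [0..<n]]])"
  using assms by (auto simp: level_inv_def clustering_def lessThan_atLeast0)

lemma level_inv_length:
  assumes "level_inv n k0 (k, L)" "1 \<le> n"
  shows "length L \<le> n ^ (2 * (k0 - 1))"
proof -
  have "length L * 1 \<le> length L * n ^ (2 * (k - 1))" using assms by (intro mult_le_mono) auto
  also have "\<dots> = n ^ (2 * (k0 - 1))" using assms unfolding level_inv_def by simp
  finally show ?thesis by simp
qed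

lemma candidates_inv:
  assumes M: "good_matrix n M" and n: "1 \<le> n" "1 \<le> k"
  shows "\<forall>cs\<in>set (candidates M k). clustering n cs" "length (candidates M k) \<le> n ^ (2 * (k - 1))"
proof -
  have "level_inv n k a \<Longrightarrow> level_inv n k (fold (level M) ws a)" for ws a
  proof (induction ws arbitrary: a)
    case (Cons w ws)
    show ?case unfolding fold_simps by (rule Cons.IH[OF level_inv_level[OF M Cons.prems]])
  qed simp
  from this[OF level_inv_init[OF n], of M] have "level_inv n k (fold (level M) M (k, [[rev [0..<n]]]))" .
  then obtain j L where L: "fold (level M) M (k, [[rev [0..<n]]]) = (j, L)" "level_inv n k (j, L)"
    by (metis surj_pair)
  have "candidates M k = L" using L M unfolding candidates_def good_matrix_def by simp
  with L(2) level_inv_length[OF L(2) n(1)] show "\<forall>cs\<in>set (candidates M k). clustering n cs"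
    "length (candidates M k) \<le> n ^ (2 * (k - 1))" by (auto simp: level_inv_def)
qed

text \<open>Variables: 0 is \<open>k\<close>, 1 the distance matrix.\<close>

definition candidates_prog :: prog where
  "candidates_prog = Op1 Snd (Fold (Var 1)
     (Op2 MkCell (Var 0) (Op2 MkCell (Op2 MkCell (Bind (Var 1) points_prog) NullC) NullC))
     (Ite (Op2 Less (Const 1) (Op1 Fst (Var 0)))
       (Op2 MkCell (Op2 Minus (Op1 Fst (Var 0)) (Const 1))
         (Bind (Var 4) (Bind (Op1 Snd (Var 1)) expand_prog)))
       (Var 0)))"

lemma ev_candidates:
  assumes M: "good_matrix n M" and n: "1 \<le> n" "1 \<le> k"
  shows "ev (nat_val k # rows_val M # E) candidates_prog (clusterings_val (candidates M k))
    (600 * (n ^ (2 * (k - 1)) * n ^ 6))"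
proof -
  define N where "N = n ^ (2 * (k - 1))"
  have N: "1 \<le> N" using n unfolding N_def by simp
  define ea :: "nat \<times> nat list list list \<Rightarrow> val" where "ea = (\<lambda>(i, xs). Cell (nat_val i) (clusterings_val xs))"
  have M': "length M = n" "\<forall>w\<in>set M. length w = n" using M unfolding good_matrix_def by auto
  have "ev (nat_val k # rows_val M # E) (Fold (Var 1)
     (Op2 MkCell (Var 0) (Op2 MkCell (Op2 MkCell (Bind (Var 1) points_prog) NullC) NullC))
     (Ite (Op2 Less (Const 1) (Op1 Fst (Var 0)))
       (Op2 MkCell (Op2 Minus (Op1 Fst (Var 0)) (Const 1))
         (Bind (Var 4) (Bind (Op1 Snd (Var 1)) expand_prog)))
       (Var 0))) (ea (fold (level M) M (k, [[rev [0..<length M]]])))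
      (1 + (50 * n + 10) + length M * ((400 * (N * n ^ 5) + 16) + 17) + 10)"
  \<comment> \<open>A round costs time proportional to the number of clusterings in the accumulator;
    the invariant bounds this number by \<open>N\<close> in all rounds.\<close>
  proof (rule ev_Fold[where ex = row_val and Inv = "level_inv n k"])
    show "ev (nat_val k # rows_val M # E) (Var 1) (list_val (map row_val M)) 1"
      unfolding rows_val_def by (rule ev_Var)
    show "ev (nat_val k # rows_val M # E)
     (Op2 MkCell (Var 0) (Op2 MkCell (Op2 MkCell (Bind (Var 1) points_prog) NullC) NullC))
     (ea (k, [[rev [0..<length M]]])) (50 * n + 10)"
      by (rule ev_cong, (rule ev_straight ev_points[OF M'(1) n(1)])+)
        (auto simp: ea_def clusterings_val_def clusters_val_eq M')
    show "level_inv n k (k, [[rev [0..<length M]]])"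
      using level_inv_init[OF n] M' by simp
    show "level_inv n k (level M w a)" if "level_inv n k a" for w a
      using level_inv_level[OF M that] .
    fix w st and a :: "nat \<times> nat list list list"
    obtain i L where a: "a = (i, L)" by (cases a)
    assume inv: "level_inv n k a"
    have L: "\<forall>cs\<in>set L. clustering n cs" "length L \<le> N" "1 \<le> i"
      using inv a level_inv_length[of n k i L] n(1) by (auto simp: level_inv_def N_def)
    show "ev (ea a # row_val w # st # nat_val k # rows_val M # E)
     (Ite (Op2 Less (Const 1) (Op1 Fst (Var 0)))
       (Op2 MkCell (Op2 Minus (Op1 Fst (Var 0)) (Const 1))
         (Bind (Var 4) (Bind (Op1 Snd (Var 1)) expand_prog)))
       (Var 0)) (ea (level M w a)) (400 * (N * n ^ 5) + 16)"
      unfolding a ea_def prod.case nat_val_def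
      by (rule ev_cong, (rule ev_straight ev_Ite ev_expand[OF L(1,2) N M' n(1)])+)
        (use L in \<open>auto simp: level_def nat_val_def of_nat_diff\<close>)
  qed
  then have "ev (nat_val k # rows_val M # E) (Fold (Var 1)
     (Op2 MkCell (Var 0) (Op2 MkCell (Op2 MkCell (Bind (Var 1) points_prog) NullC) NullC))
     (Ite (Op2 Less (Const 1) (Op1 Fst (Var 0)))
       (Op2 MkCell (Op2 Minus (Op1 Fst (Var 0)) (Const 1))
         (Bind (Var 4) (Bind (Op1 Snd (Var 1)) expand_prog)))
       (Var 0))) (Cell (nat_val (fst (fold (level M) M (k, [[rev [0..<length M]]]))))
         (clusterings_val (candidates M k)))
      (1 + (50 * n + 10) + length M * ((400 * (N * n ^ 5) + 16) + 17) + 10)"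
    by (simp add: ea_def candidates_def split_beta)
  from ev_Snd[OF this] show ?thesis unfolding candidates_prog_def N_def[symmetric]
  proof (rule ev_mono)
    have "n * 1 \<le> n * (N * n ^ 5)" using N n by (intro mult_le_mono) auto
    then have "1 + (50 * n + 10) + 10 \<le> 71 * (n * (N * n ^ 5))" using n by linarith
    then have "1 + (50 * n + 10) + length M * ((400 * (N * n ^ 5) + 16) + 17) + 10
        \<le> (433 + 71) * (n * (N * n ^ 5))"
      using N n M' by (intro fold_time) simp_all
    also have "n * (N * n ^ 5) = N * n ^ 6" by (simp flip: power_Suc)
    finally show "1 + (50 * n + 10) + length M * ((400 * (N * n ^ 5) + 16) + 17) + 10 + 1
        \<le> 600 * (N * n ^ 6)"
      using N n by simp
  qed
qed

section \<open>Diameter and cost evaluated from the distance matrix\<close>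

definition row_max :: "nat list \<Rightarrow> real list \<Rightarrow> real \<Rightarrow> real" where
  "row_max c w = fold (\<lambda>y b. if b < w ! y then w ! y else b) c"

definition list_diam :: "real list list \<Rightarrow> nat list \<Rightarrow> real" where
  "list_diam M c = fold (\<lambda>x. row_max c (M ! x)) c 0"

definition cost_of_lists :: "real list list \<Rightarrow> nat list list \<Rightarrow> real" where
  "cost_of_lists M cs = fold (\<lambda>c b. b + list_diam M c) cs 0"

text \<open>Variables: 0 is a cluster, 1 the distance matrix.\<close>

definition diameter_prog :: prog where
  "diameter_prog = Fold (Var 0) (Const 0)
     (Bind (Bind (Var 4) (Bind (Var 2) nth_prog))
       (Fold (Var 4) (Var 1) (Bind (Bind (Var 3) (Bind (Var 2) nth_prog))
         (Ite (Op2 Less (Var 1) (Var 0)) (Var 0) (Var 1)))))"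

lemma ev_diameter:
  assumes c: "length c \<le> n" "\<forall>x\<in>set c. x < n"
    and M: "length M = n" "\<forall>w\<in>set M. length w = n" and n: "1 \<le> n"
  shows "ev (cluster_val c # rows_val M # E) diameter_prog (Num (list_diam M c)) (200 * n ^ 3)"
proof -
  have row: "ev (row_val w # Num b # x # s # cluster_val c # E')
     (Fold (Var 4) (Var 1) (Bind (Bind (Var 3) (Bind (Var 2) nth_prog))
         (Ite (Op2 Less (Var 1) (Var 0)) (Var 0) (Var 1)))) (Num (row_max c w b)) (100 * n ^ 2)"
    if lw: "length w = n" for w b x s E'
  proof -
    have "ev (row_val w # Num b # x # s # cluster_val c # E')
      (Fold (Var 4) (Var 1) (Bind (Bind (Var 3) (Bind (Var 2) nth_prog))
         (Ite (Op2 Less (Var 1) (Var 0)) (Var 0) (Var 1)))) (Num (row_max c w b))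
      (1 + 1 + length c * ((45 * n + 15) + 17) + 10)"
      unfolding row_max_def
    proof (rule ev_Fold[where ex = nat_val and Inv = "\<lambda>_. True"])
      show "ev (row_val w # Num b # x # s # cluster_val c # E') (Var 4) (list_val (map nat_val c)) 1"
        unfolding cluster_val_def by (rule ev_Var)
      fix y b2 s2 assume "y \<in> set c"
      then have y: "y < length w" using c lw by simp
      show "ev (Num b2 # nat_val y # s2 # row_val w # Num b # x # s # cluster_val c # E')
         (Bind (Bind (Var 3) (Bind (Var 2) nth_prog)) (Ite (Op2 Less (Var 1) (Var 0)) (Var 0) (Var 1)))
         (Num (if b2 < w ! y then w ! y else b2)) (45 * n + 15)"
        by (rule ev_cong, (rule ev_straight ev_Ite ev_nth_row[OF y])+) (use lw in auto)
    qed (rule ev_Var TrueI)+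
    then show ?thesis
    proof (rule ev_mono)
      have "1 + 1 + length c * ((45 * n + 15) + 17) + 10 \<le> (77 + 12) * (n * n)"
        using c n by (intro fold_time) auto
      then show "1 + 1 + length c * ((45 * n + 15) + 17) + 10 \<le> 100 * n ^ 2"
        using n by (simp add: power2_eq_square)
    qed
  qed
  have "ev (cluster_val c # rows_val M # E) diameter_prog (Num (list_diam M c))
      (1 + 1 + length c * ((100 * n ^ 2 + 45 * n + 10) + 17) + 10)"
    unfolding diameter_prog_def list_diam_def
  proof (rule ev_Fold[where ex = nat_val and Inv = "\<lambda>_. True"])
    show "ev (cluster_val c # rows_val M # E) (Var 0) (list_val (map nat_val c)) 1"
      unfolding cluster_val_def by (rule ev_Var)
    fix x b s assume "x \<in> set c"
    then have x: "x < length M" "length (M ! x) = n" using c M by auto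
    show "ev (Num b # nat_val x # s # cluster_val c # rows_val M # E)
     (Bind (Bind (Var 4) (Bind (Var 2) nth_prog))
       (Fold (Var 4) (Var 1) (Bind (Bind (Var 3) (Bind (Var 2) nth_prog))
         (Ite (Op2 Less (Var 1) (Var 0)) (Var 0) (Var 1)))))
     (Num (row_max c (M ! x) b)) (100 * n ^ 2 + 45 * n + 10)"
      by (rule ev_cong, (rule row[OF x(2)] ev_straight ev_nth_rows[OF x(1)])+) (use M in auto)
  qed (rule ev_Const TrueI)+
  then show ?thesis
  proof (rule ev_mono)
    have "n * 1 \<le> n * n" using n by (intro mult_le_mono) auto
    then have "n \<le> n ^ 2" "1 \<le> n ^ 2" using n by (auto simp: power2_eq_square)
    then have "(100 * n ^ 2 + 45 * n + 10) + 17 \<le> 172 * n ^ 2" by linarith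
    then have "1 + 1 + length c * ((100 * n ^ 2 + 45 * n + 10) + 17) + 10 \<le> (172 + 12) * (n * n ^ 2)"
      using c n by (intro fold_time) simp_all
    then show "1 + 1 + length c * ((100 * n ^ 2 + 45 * n + 10) + 17) + 10 \<le> 200 * n ^ 3"
      by (simp flip: power_Suc)
  qed
qed

text \<open>Variables: 0 is a clustering, 1 the distance matrix.\<close>

definition total_prog :: prog where
  "total_prog = Fold (Var 0) (Const 0) (Op2 Plus (Var 0) (Bind (Var 4) (Bind (Var 2) diameter_prog)))"

text \<open>Lists have no random access: clusters, pairs of points and the walk to a matrix entry
  make four nested loops, hence the fourth power.\<close>

lemma ev_total:
  assumes cs: "clustering n cs"
    and M: "length M = n" "\<forall>w\<in>set M. length w = n" and n: "1 \<le> n"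
  shows "ev (clusters_val cs # rows_val M # E) total_prog (Num (cost_of_lists M cs)) (300 * n ^ 4)"
proof -
  have "ev (clusters_val cs # rows_val M # E) total_prog (Num (cost_of_lists M cs))
     (1 + 1 + length cs * ((200 * n ^ 3 + 10) + 17) + 10)"
    unfolding total_prog_def cost_of_lists_def
  proof (rule ev_Fold[where ex = cluster_val and Inv = "\<lambda>_. True"])
    show "ev (clusters_val cs # rows_val M # E) (Var 0) (list_val (map cluster_val cs)) 1"
      unfolding clusters_val_eq by (rule ev_Var)
    fix c b s assume "c \<in> set cs"
    then have c: "length c \<le> n" "\<forall>x\<in>set c. x < n" using clustering_member[OF cs] by auto
    show "ev (Num b # cluster_val c # s # clusters_val cs # rows_val M # E)
      (Op2 Plus (Var 0) (Bind (Var 4) (Bind (Var 2) diameter_prog))) (Num (b + list_diam M c))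
      (200 * n ^ 3 + 10)"
      by (rule ev_cong, (rule ev_straight ev_diameter[OF c M n])+) auto
  qed (rule ev_Const TrueI)+
  then show ?thesis
  proof (rule ev_mono)
    have "1 + 1 + length cs * ((200 * n ^ 3 + 10) + 17) + 10 \<le> (227 + 12) * (n * n ^ 3)"
      using clustering_length[OF cs] n by (intro fold_time) auto
    then show "1 + 1 + length cs * ((200 * n ^ 3 + 10) + 17) + 10 \<le> 300 * n ^ 4"
      by (simp flip: power_Suc)
  qed
qed

section \<open>Selection of a cheapest feasible candidate\<close>

definition better :: "real list list \<Rightarrow> (nat list list \<Rightarrow> bool) \<Rightarrow> nat list list \<Rightarrow>
    (real \<times> nat list list) option \<Rightarrow> (real \<times> nat list list) option" where
  "better M ok cs b = (if ok cs \<and> (b = None \<or> cost_of_lists M cs < fst (the b)) then Some (cost_of_lists M cs, cs) else b)"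

definition best :: "real list list \<Rightarrow> (nat list list \<Rightarrow> bool) \<Rightarrow> nat list list list \<Rightarrow>
    (real \<times> nat list list) option" where
  "best M ok L = fold (better M ok) L None"

definition best_val :: "(real \<times> nat list list) option \<Rightarrow> val" where
  "best_val b = (case b of None \<Rightarrow> Null | Some (r, cs) \<Rightarrow> Cell (Num r) (clusters_val cs))"

text \<open>Variables: 0 is a cost, 1 the best clustering so far (with its cost), 2 a clustering.\<close>

definition update_prog :: prog where
  "update_prog = Ite (Op1 IsNull (Var 1)) (Op2 MkCell (Var 0) (Var 2))
     (Ite (Op2 Less (Var 0) (Op1 Fst (Var 1))) (Op2 MkCell (Var 0) (Var 2)) (Var 1))"

lemma ev_update:
  "ev (Num x # best_val b # clusters_val cs # E) update_prog
     (best_val (if b = None \<or> x < fst (the b) then Some (x, cs) else b)) 20"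
proof (cases b)
  case None
  show ?thesis unfolding None best_val_def option.case update_prog_def
    by (rule ev_cong, rule ev_Ite_True, (rule ev_straight)+) auto
next
  case (Some rc)
  obtain r cs' where rc: "rc = (r, cs')" by (cases rc)
  show ?thesis unfolding Some rc best_val_def option.case prod.case update_prog_def
    by (rule ev_cong, (rule ev_straight ev_Ite)+) auto
qed

definition output_prog :: prog where
  "output_prog = Ite (Op1 IsNull (Var 0)) NullC (Op1 Snd (Var 0))"

lemma ev_output:
  "ev (best_val b # E) output_prog
     (case b of None \<Rightarrow> Null | Some (r, cs) \<Rightarrow> clusters_val cs) 6"
proof (cases b)
  case None
  show ?thesis unfolding None best_val_def option.case output_prog_def
    by (rule ev_cong, rule ev_Ite_True, (rule ev_straight)+) auto
next
  case (Some rc)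
  obtain r cs' where rc: "rc = (r, cs')" by (cases rc)
  show ?thesis unfolding Some rc best_val_def option.case prod.case output_prog_def
    by (rule ev_cong, (rule ev_straight ev_Ite)+) auto
qed

text \<open>
  Variable 0 is the input of the problem; the feasibility check \<open>p\<close> is run in an environment
  whose variable 0 is its own input.
\<close>

definition search_prog :: "prog \<Rightarrow> prog" where
  "search_prog p =
     Bind (Bind (Op1 Fst (Op1 Snd (Var 0))) (Bind (Op1 Fst (Op1 Snd (Op1 Snd (Op1 Snd (Var 1))))) candidates_prog))
     (Bind (Fold (Var 0) NullC
        (Ite (Bind (Op2 MkCell (Op1 Fst (Var 4)) (Op2 MkCell (Op1 Fst (Op1 Snd (Var 4)))
               (Op2 MkCell (Op1 Fst (Op1 Snd (Op1 Snd (Var 4)))) (Op2 MkCell (Var 1) NullC)))) p)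
          (Bind (Bind (Op1 Fst (Op1 Snd (Var 4))) (Bind (Var 2) total_prog)) update_prog)
          (Var 0)))
     output_prog)"

text \<open>The checker enters only through the predicate \<open>ok\<close> that it decides and its
  bound \<open>F\<close>; the side information \<open>s\<close> is handed on unread. Up to
  constants, each candidate costs \<open>F\<close> plus \<open>n ^ 4\<close> for its cost, and
  \<open>1 \<le> F\<close> turns this sum into a product.\<close>

lemma ev_search:
  assumes M: "good_matrix n M" and n: "1 \<le> n" "1 \<le> k" and F: "1 \<le> F"
    and p: "\<And>cs. clustering n cs \<Longrightarrow>
       ev [list_val [nat_val n, rows_val M, s, clusters_val cs]] p (truth (ok cs)) F"
  shows "ev [list_val [nat_val n, rows_val M, s, nat_val k]] (search_prog p)
    (case best M ok (candidates M k) of None \<Rightarrow> Null | Some (r, cs) \<Rightarrow> clusters_val cs)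
    (1200 * (n ^ (2 * (k - 1)) * n ^ 6 * F))"
proof -
  define N where "N = n ^ (2 * (k - 1))"
  have N: "1 \<le> N" using n unfolding N_def by simp
  have M': "length M = n" "\<forall>w\<in>set M. length w = n" using M unfolding good_matrix_def by auto
  define inp where "inp = Cell (nat_val n) (Cell (rows_val M) (Cell s (Cell (nat_val k) Null)))"
  define L where "L = candidates M k"
  note L = candidates_inv[OF M n, folded L_def N_def]
  define loop where "loop = Fold (Var 0) NullC
        (Ite (Bind (Op2 MkCell (Op1 Fst (Var 4)) (Op2 MkCell (Op1 Fst (Op1 Snd (Var 4)))
               (Op2 MkCell (Op1 Fst (Op1 Snd (Op1 Snd (Var 4)))) (Op2 MkCell (Var 1) NullC)))) p)
          (Bind (Bind (Op1 Fst (Op1 Snd (Var 4))) (Bind (Var 2) total_prog)) update_prog)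
          (Var 0))"
  have "ev [clusterings_val L, inp] loop (best_val (best M ok L))
     (1 + 1 + length L * ((F + 300 * n ^ 4 + 60) + 17) + 10)"
    unfolding loop_def best_def
  proof (rule ev_Fold[where ex = clusters_val and Inv = "\<lambda>_. True"])
    show "ev [clusterings_val L, inp] (Var 0) (list_val (map clusters_val L)) 1"
      unfolding clusterings_val_def by (rule ev_Var)
    show "ev [clusterings_val L, inp] NullC (best_val None) 1"
      unfolding best_val_def option.case by (rule ev_NullC)
    fix cs b st assume "cs \<in> set L"
    then have cs: "clustering n cs" using L by blast
    have p': "ev (Cell (nat_val n) (Cell (rows_val M) (Cell s (Cell (clusters_val cs) Null))) # E) p
        (truth (ok cs)) F" for E
      using ev_append[OF p[OF cs], of E] by simp
    show "ev [best_val b, clusters_val cs, st, clusterings_val L, inp]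
      (Ite (Bind (Op2 MkCell (Op1 Fst (Var 4)) (Op2 MkCell (Op1 Fst (Op1 Snd (Var 4)))
               (Op2 MkCell (Op1 Fst (Op1 Snd (Op1 Snd (Var 4)))) (Op2 MkCell (Var 1) NullC)))) p)
          (Bind (Bind (Op1 Fst (Op1 Snd (Var 4))) (Bind (Var 2) total_prog)) update_prog)
          (Var 0)) (best_val (better M ok cs b)) (F + 300 * n ^ 4 + 60)"
      unfolding inp_def
      by (rule ev_cong, (rule p' ev_total[OF cs M' n(1)] ev_update ev_straight ev_Ite)+)
        (auto simp: better_def)
  qed (rule TrueI)+
  then have loop: "ev [clusterings_val L, inp] loop (best_val (best M ok L)) (400 * (N * n ^ 6 * F))"
  proof (rule ev_mono)
    have pow: "n ^ 4 \<le> n ^ 6" "1 \<le> n ^ 4" using n by (auto intro: power_increasing)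
    have "F * 1 \<le> F * n ^ 4" "1 * n ^ 4 \<le> F * n ^ 4" using F pow by (intro mult_le_mono; simp)+
    moreover have "1 * (1 * 1) \<le> N * (F * n ^ 4)" using N F pow by (intro mult_le_mono) auto
    ultimately have "F + 300 * n ^ 4 + 60 + 17 \<le> 380 * (F * n ^ 4)" "1 + 1 + 10 \<le> 12 * (N * (F * n ^ 4))"
      using pow by linarith+
    then have "1 + 1 + length L * ((F + 300 * n ^ 4 + 60) + 17) + 10 \<le> (380 + 12) * (N * (F * n ^ 4))"
      using L(2) by (intro fold_time)
    also have "\<dots> \<le> 400 * (N * (F * n ^ 6))" using pow by (intro mult_le_mono) auto
    finally show "1 + 1 + length L * ((F + 300 * n ^ 4 + 60) + 17) + 10 \<le> 400 * (N * n ^ 6 * F)"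
      by (simp add: ac_simps)
  qed
  have cand: "ev (nat_val k # rows_val M # E) candidates_prog (clusterings_val L) (600 * (N * n ^ 6))" for E
    unfolding L_def N_def by (rule ev_candidates[OF M n])
  have "ev [inp] (search_prog p)
     (case best M ok L of None \<Rightarrow> Null | Some (r, cs) \<Rightarrow> clusters_val cs)
     (3 + (5 + 600 * (N * n ^ 6) + 1) + 1 + ((400 * (N * n ^ 6 * F)) + 6 + 1) + 1)"
  proof -
    have "ev [inp] (Bind (Op1 Fst (Op1 Snd (Var 0)))
        (Bind (Op1 Fst (Op1 Snd (Op1 Snd (Op1 Snd (Var 1))))) candidates_prog)) (clusterings_val L)
        (3 + (5 + 600 * (N * n ^ 6) + 1) + 1)"
      unfolding inp_def by (rule ev_cong, (rule cand ev_straight)+) auto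
    from ev_Bind[OF this ev_Bind[OF loop ev_output]] show ?thesis
      unfolding search_prog_def loop_def .
  qed
  moreover have "[inp] = [list_val [nat_val n, rows_val M, s, nat_val k]]" by (simp add: inp_def)
  ultimately show ?thesis unfolding N_def[symmetric] L_def[symmetric]
  proof (simp only:, elim ev_mono)
    have "1 * 1 * 1 \<le> N * n ^ 6 * F" "N * n ^ 6 * 1 \<le> N * n ^ 6 * F"
      using N n F by (intro mult_le_mono; simp)+
    then show "3 + (5 + 600 * (N * n ^ 6) + 1) + 1 + ((400 * (N * n ^ 6 * F)) + 6 + 1) + 1
       \<le> 1200 * (N * n ^ 6 * F)" by linarith
  qed
qed

section \<open>Optimal solutions with the fewest clusters\<close>

text \<open>A block outside \<open>J\<close> is disjoint from the blocks of \<open>J\<close>,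
  whereas the union contains one. So merging inserts a new block, and cardinalities and costs can be
  computed exactly.\<close>

lemma partition_on_Union_notin:
  assumes "partition_on A P" "J \<subseteq> P" "J \<noteq> {}"
  shows "\<Union>J \<notin> P - J"
proof
  assume U: "\<Union>J \<in> P - J"
  obtain C where C: "C \<in> J" using assms by auto
  then have "C \<in> P" "C \<noteq> \<Union>J" using assms U by auto
  then have "C \<inter> \<Union>J = {}" using assms U partition_onD2[OF assms(1)] by (auto simp: disjoint_def)
  then have "C = {}" using C by auto
  then show False using \<open>C \<in> P\<close> partition_onD3[OF assms(1)] by simp
qed

text \<open>Mergeability joins only two blocks, so the members of \<open>J\<close> are absorbed one
  at a time.\<close>

lemma merge_many:
  assumes mg: "mergeable I" and part: "partition_on A P" and P: "P \<in> feasible I"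
    and "finite J" "J \<noteq> {}" "J \<subseteq> P"
  shows "insert (\<Union>J) (P - J) \<in> feasible I"
  using assms(4-6)
proof (induction J rule: finite_ne_induct)
  case (singleton C)
  then show ?case using P by (simp add: insert_absorb)
next
  case (insert C J)
  let ?Q = "insert (\<Union>J) (P - J)"
  have Q: "?Q \<in> feasible I" using insert by simp
  have "C \<inter> D = {}" if "D \<in> J" for D
  proof (rule disjointD[OF partition_onD2[OF part]])
    show "C \<in> P" "D \<in> P" "C \<noteq> D" using insert that by auto
  qed
  then have disj: "C \<inter> \<Union>J = {}" by blast
  have "C \<noteq> {}" using insert partition_onD3[OF part] by auto
  then have ne: "C \<noteq> \<Union>J" using disj by auto
  have "insert (C \<union> \<Union>J) (?Q - {C, \<Union>J}) \<in> feasible I"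
  proof (rule mg[unfolded mergeable_def, rule_format, OF Q])
    show "C \<in> ?Q" "\<Union>J \<in> ?Q" using insert by auto
  qed (rule ne)
  moreover have "\<Union>J \<notin> P - J" using partition_on_Union_notin[OF part] insert by simp
  then have "?Q - {C, \<Union>J} = P - insert C J" by auto
  ultimately show ?case by simp
qed

lemma sum_diam_less_diam_Union:
  assumes I: "valid_instance I" "mergeable I" and P: "P \<in> feasible I" "finite P"
    and opt: "\<And>Q. Q \<in> feasible I \<Longrightarrow> card Q < card P \<Longrightarrow> cost I P < cost I Q"
    and J: "J \<subseteq> P" "2 \<le> card J"
  shows "(\<Sum>C\<in>J. diam (distance I) C) < diam (distance I) (\<Union>J)"
proof -
  have part: "partition_on (points I) P" using I P unfolding valid_instance_def by blast
  have fin: "finite J" and ne: "J \<noteq> {}" using J by (auto intro: finite_subset[OF _ P(2)])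
  let ?Q = "insert (\<Union>J) (P - J)"
  have notin: "\<Union>J \<notin> P - J" by (rule partition_on_Union_notin[OF part J(1) ne])
  have "card ?Q = Suc (card P - card J)"
    using notin fin J P card_Diff_subset[of J P] by simp
  moreover have "card J \<le> card P" using J P card_mono by blast
  ultimately have "card ?Q < card P" using J by simp
  then have "cost I P < cost I ?Q" by (rule opt[OF merge_many[OF I(2) part P(1) fin ne J(1)]])
  \<comment> \<open>The blocks in \<open>P - J\<close> contribute equally to both costs; cancelling
    them leaves the comparison of \<open>J\<close> with its union.\<close>
  moreover have "cost I P = (\<Sum>C\<in>P - J. diam (distance I) C) + (\<Sum>C\<in>J. diam (distance I) C)"
    unfolding cost_def using P J by (simp add: sum.subset_diff)
  ultimately show ?thesis using notin P by (simp add: cost_def)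
qed

text \<open>Subadditivity of Lebesgue measure. The right end of the range is left out because a
  separating radius has to be smaller than the largest distance, so that a point remains outside the
  ball.\<close>

lemma interval_cover_length:
  fixes l u :: "'a \<Rightarrow> real"
  assumes "finite J" "{0..<R} \<subseteq> (\<Union>C\<in>J. {l C..u C})" "\<And>C. C \<in> J \<Longrightarrow> l C \<le> u C" "0 \<le> R"
  shows "R \<le> (\<Sum>C\<in>J. u C - l C)"
proof -
  have "measure lborel {0..<R} \<le> measure lborel (\<Union>C\<in>J. {l C..u C})"
    using assms by (intro measure_mono_fmeasurable fmeasurable_compact compact_UN) auto
  also have "\<dots> \<le> (\<Sum>C\<in>J. measure lborel {l C..u C})"
    using assms by (intro measure_UNION_le) auto
  also have "\<dots> = (\<Sum>C\<in>J. u C - l C)" using assms by (intro sum.cong) auto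
  finally show ?thesis using assms by simp
qed

lemma dist_le_diam:
  assumes "finite C" "x \<in> C" "y \<in> C"
  shows "d x y \<le> diam d C"
proof -
  have "{d x y | x y. x \<in> C \<and> y \<in> C} = (\<lambda>(x, y). d x y) ` (C \<times> C)" by auto
  then have "finite {d x y | x y. x \<in> C \<and> y \<in> C}" using assms by simp
  then show ?thesis unfolding diam_def using assms by (intro Max_ge) auto
qed

lemma diam_attained:
  assumes "finite C" "C \<noteq> {}"
  obtains x y where "x \<in> C" "y \<in> C" "d x y = diam d C"
proof -
  have "{d x y | x y. x \<in> C \<and> y \<in> C} = (\<lambda>(x, y). d x y) ` (C \<times> C)" by auto
  then have "finite {d x y | x y. x \<in> C \<and> y \<in> C}" using assms by simp
  from Max_in[OF this] assms have "diam d C \<in> {d x y | x y. x \<in> C \<and> y \<in> C}"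
    unfolding diam_def by auto
  then show ?thesis using that by auto
qed

text \<open>
  The distances from \<open>u\<close> to the points of a set \<open>C\<close> lie in an interval of length at most the diameter
  of \<open>C\<close>. For an endpoint \<open>u\<close> of a diameter of \<open>\<Union>J\<close> these intervals are too short to cover the range
  of distances from \<open>u\<close>; a radius in a gap separates the members of \<open>J\<close>.
\<close>

lemma separating_ball:
  assumes met: "Metric_space X d" and J: "finite J" "\<And>C. C \<in> J \<Longrightarrow> finite C \<and> C \<noteq> {} \<and> C \<subseteq> X"
    and less: "(\<Sum>C\<in>J. diam d C) < diam d (\<Union>J)" and ne: "J \<noteq> {}"
  obtains u w v where "u \<in> \<Union>J" "w \<in> \<Union>J" "v \<in> \<Union>J" "d u w < d u v"
    "\<And>C. C \<in> J \<Longrightarrow> (\<forall>x\<in>C. d u x \<le> d u w) \<or> (\<forall>x\<in>C. d u w < d u x)"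
proof -
  interpret Metric_space X d by fact
  let ?S = "\<Union>J"
  have S: "finite ?S" "?S \<noteq> {}" "?S \<subseteq> X" using J ne by auto
  obtain u v where uv: "u \<in> ?S" "v \<in> ?S" "d u v = diam d ?S" using diam_attained[OF S(1,2)] .
  have "\<exists>w\<in>?S. d u w < d u v \<and> (\<forall>C\<in>J. (\<forall>x\<in>C. d u x \<le> d u w) \<or> (\<forall>x\<in>C. d u w < d u x))"
  proof (rule ccontr)
    assume "\<not> ?thesis"
    then have no: "\<exists>C\<in>J. (\<exists>x\<in>C. d u w < d u x) \<and> (\<exists>x\<in>C. d u x \<le> d u w)"
      if "w \<in> ?S" "d u w < d u v" for w
      using that by (meson not_le)
    define l h where "l C = Min (d u ` C)" and "h C = Max (d u ` C)" for C
    have lh: "l C \<le> d u x \<and> d u x \<le> h C" if "C \<in> J" "x \<in> C" for C x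
      using J that unfolding l_def h_def by auto
    have "d u v \<le> (\<Sum>C\<in>J. h C - l C)"
    proof (rule interval_cover_length[OF J(1)])
      show "l C \<le> h C" if "C \<in> J" for C using lh that J by (meson all_not_in_conv order_trans)
      show "{0..<d u v} \<subseteq> (\<Union>C\<in>J. {l C..h C})"
      proof
        fix t assume t: "t \<in> {0..<d u v}"
        \<comment> \<open>Round \<open>t\<close> down to an attained distance \<open>d u w\<close>.
          Some \<open>C\<close> straddles that radius, and since no distance lies strictly between
          \<open>d u w\<close> and \<open>t\<close> or equals \<open>t\<close> without being
          \<open>d u w\<close>, its farther point is already beyond \<open>t\<close>. So
          \<open>t\<close> lies in the interval of \<open>C\<close>.\<close>
        let ?T = "{x \<in> ?S. d u x \<le> t}"
        have "finite ?T" by (rule finite_subset[OF _ S(1)]) auto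
        then have T: "finite (d u ` ?T)" by simp
        have "u \<in> X" using S uv by blast
        then have "d u u = 0" by simp
        then have "u \<in> ?T" using uv t by simp
        then have "Max (d u ` ?T) \<in> d u ` ?T" by (intro Max_in[OF T]) blast
        then obtain w where w: "w \<in> ?T" "d u w = Max (d u ` ?T)" by fastforce
        have le: "d u x \<le> d u w" if "x \<in> ?T" for x
          unfolding w(2) using that by (intro Max_ge[OF T]) blast
        obtain C a b where C: "C \<in> J" "a \<in> C" "b \<in> C" "d u w < d u b" "d u a \<le> d u w"
          using no[of w] w(1) t by fastforce
        have "t < d u b"
        proof (rule ccontr)
          assume "\<not> t < d u b"
          then have "d u b \<le> d u w" using C by (intro le) auto
          then show False using C by simp
        qed
        then have "l C \<le> t" "t \<le> h C" using lh[OF C(1,2)] lh[OF C(1,3)] C w by auto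
        then show "t \<in> (\<Union>C\<in>J. {l C..h C})" using C by auto
      qed
    qed simp
    also have "\<dots> \<le> (\<Sum>C\<in>J. diam d C)"
    proof (rule sum_mono)
      fix C assume C: "C \<in> J"
      have fin: "finite (d u ` C)" "d u ` C \<noteq> {}" using J C by auto
      obtain a b where ab: "a \<in> C" "b \<in> C" "l C = d u a" "h C = d u b"
        using Min_in[OF fin] Max_in[OF fin] unfolding l_def h_def by auto
      have "u \<in> X" "a \<in> X" "b \<in> X" using uv S ab J C by auto
      then have "h C - l C \<le> d a b" using triangle[of u a b] ab by simp
      also have "\<dots> \<le> diam d C" using J C ab by (intro dist_le_diam) auto
      finally show "h C - l C \<le> diam d C" .
    qed
    finally show False using less uv by simp
  qed
  then show ?thesis using that uv by blast
qed

section \<open>Correctness of the search\<close>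

definition matrix_rows :: "nat \<Rightarrow> (nat \<Rightarrow> nat \<Rightarrow> real) \<Rightarrow> real list list" where
  "matrix_rows n d = map (\<lambda>i. map (d i) [0..<n]) [0..<n]"

lemma rows_nth: "i < n \<Longrightarrow> j < n \<Longrightarrow> matrix_rows n d ! i ! j = d i j"
  by (simp add: matrix_rows_def)

lemma matrix_val_eq: "matrix_val n d = rows_val (matrix_rows n d)"
  by (simp add: matrix_val_def rows_val_def matrix_rows_def row_val_def[abs_def] comp_def)

lemma good_matrix_rows:
  assumes "Metric_space X d"
  shows "good_matrix n (matrix_rows n d)"
  using Metric_space.nonneg[OF assms] by (auto simp: good_matrix_def matrix_rows_def)

lemma row_max_eq: "row_max c w b = Max (insert b ((!) w ` set c))"
  unfolding row_max_def
proof (induction c arbitrary: b)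
  case (Cons x c)
  have "(if b < w ! x then w ! x else b) = max b (w ! x)" by (simp add: max_def)
  then have "fold (\<lambda>y b. if b < w ! y then w ! y else b) (x # c) b
      = Max (insert (max b (w ! x)) ((!) w ` set c))"
    by (simp add: Cons.IH)
  also have "\<dots> = Max (insert b (insert (w ! x) ((!) w ` set c)))"
    by (cases "c = []") (auto simp: Max_insert max.assoc)
  finally show ?case by simp
qed simp

lemma diameter_rows:
  assumes c: "c \<noteq> []" "\<forall>x\<in>set c. x < n" and met: "Metric_space {..<n} d"
  shows "list_diam (matrix_rows n d) c = diam d (set c)"
proof -
  let ?M = "matrix_rows n d"
  have fold: "fold (\<lambda>x. row_max c (?M ! x)) c' b = Max (insert b {?M ! x ! y | x y. x \<in> set c' \<and> y \<in> set c})"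
    for c' b
  proof (induction c' arbitrary: b)
    case (Cons z c')
    let ?A = "(!) (?M ! z) ` set c" and ?B = "{?M ! x ! y | x y. x \<in> set c' \<and> y \<in> set c}"
    have "?B = (\<lambda>(x, y). ?M ! x ! y) ` (set c' \<times> set c)" by auto
    then have fin: "finite ?B" by simp
    have "fold (\<lambda>x. row_max c (?M ! x)) (z # c') b = Max (insert (Max (insert b ?A)) ?B)"
      by (simp add: Cons.IH row_max_eq)
    also have "\<dots> = Max (insert b ?A \<union> ?B)"
      using fin by (cases "?B = {}") (simp_all only: Un_empty_right Max_singleton Max_insert Max_Un finite_insert finite_imageI finite_set insert_not_empty not_False_eq_True)
    also have "insert b ?A \<union> ?B = insert b {?M ! x ! y | x y. x \<in> set (z # c') \<and> y \<in> set c}" by auto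
    finally show ?case .
  qed simp
  have eq: "{?M ! x ! y | x y. x \<in> set c \<and> y \<in> set c} = {d x y | x y. x \<in> set c \<and> y \<in> set c}"
    using c rows_nth[of _ n _ d] by (auto; metis)
  \<comment> \<open>The fold starts at 0, which is itself the distance \<open>d x x\<close> in a
    nonempty cluster, so the maximum is unchanged.\<close>
  obtain x where x: "x \<in> set c" using c by (cases c) auto
  then have "d x x = 0" using Metric_space.zero[OF met, of x x] c by simp
  then have "0 \<in> {d x y | x y. x \<in> set c \<and> y \<in> set c}" using x by (metis (mono_tags, lifting) mem_Collect_eq)
  then show ?thesis unfolding list_diam_def fold eq diam_def by (simp add: insert_absorb)
qed

lemma clustering_distinct:
  assumes "clustering n cs"
  shows "distinct cs" "inj_on set (set cs)" "\<And>c c'. c \<in> set cs \<Longrightarrow> c' \<in> set cs \<Longrightarrow> c \<noteq> c' \<Longrightarrow> set c \<inter> set c' = {}"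
proof -
  have *: "distinct (removeAll [] cs)"
     "\<And>c c'. c \<in> set cs \<Longrightarrow> c' \<in> set cs \<Longrightarrow> c \<noteq> c' \<Longrightarrow> set c \<inter> set c' = {}"
    using assms unfolding clustering_def distinct_concat_iff by blast+
  then show "distinct cs" using assms by (simp add: clustering_def)
  show "\<And>c c'. c \<in> set cs \<Longrightarrow> c' \<in> set cs \<Longrightarrow> c \<noteq> c' \<Longrightarrow> set c \<inter> set c' = {}" by fact
  show "inj_on set (set cs)"
  proof (rule inj_onI, rule ccontr)
    fix c c' assume "c \<in> set cs" "c' \<in> set cs" "set c = set c'" "c \<noteq> c'"
    then show False using *(2)[of c c'] assms by (auto simp: clustering_def)
  qed
qed

lemma clustering_card: "clustering n cs \<Longrightarrow> card (set ` set cs) = length cs"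
  by (metis clustering_distinct(1,2) card_image distinct_card)

lemma clustering_partition:
  assumes "clustering n cs"
  shows "partition_on {..<n} (set ` set cs)" "lists_partition cs (set ` set cs)"
proof -
  show "partition_on {..<n} (set ` set cs)"
  proof (rule partition_onI)
    show "\<Union> (set ` set cs) = {..<n}" "{} \<notin> set ` set cs" using assms by (auto simp: clustering_def)
    fix p q assume "p \<in> set ` set cs" "q \<in> set ` set cs" "p \<noteq> q"
    then show "disjnt p q" using clustering_distinct(3)[OF assms] unfolding disjnt_def by blast
  qed
  show "lists_partition cs (set ` set cs)"
    using assms by (auto simp: clustering_def lists_partition_def)
qed

text \<open>Passing from the list to the set of sets loses no summand, since disjoint nonempty
  clusters differ as sets.\<close>

lemma total_rows:
  assumes cs: "clustering (num_points I) cs" and met: "Metric_space (points I) (distance I)"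
  shows "cost_of_lists (matrix_rows (num_points I) (distance I)) cs = cost I (set ` set cs)"
proof -
  let ?M = "matrix_rows (num_points I) (distance I)"
  have "fold (\<lambda>c b. b + list_diam ?M c) xs b = b + (\<Sum>c\<leftarrow>xs. list_diam ?M c)" for xs b
    by (induction xs arbitrary: b) auto
  then have "cost_of_lists ?M cs = (\<Sum>c\<leftarrow>cs. list_diam ?M c)" by (simp add: cost_of_lists_def)
  also have "\<dots> = (\<Sum>c\<in>set cs. list_diam ?M c)"
    by (rule sum_list_distinct_conv_sum_set[OF clustering_distinct(1)[OF cs]])
  also have "\<dots> = (\<Sum>c\<in>set cs. diam (distance I) (set c))"
  proof (rule sum.cong)
    fix c assume "c \<in> set cs"
    then show "list_diam ?M c = diam (distance I) (set c)"
      using clustering_member(1)[OF cs] cs met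
      by (intro diameter_rows) (auto simp: clustering_def points_def)
  qed simp
  also have "\<dots> = cost I (set ` set cs)"
    unfolding cost_def by (simp add: sum.reindex[OF clustering_distinct(2)[OF cs]])
  finally show ?thesis .
qed

section \<open>Convergence of the splits to a target partition\<close>

definition refines :: "nat set set \<Rightarrow> nat list list \<Rightarrow> bool" where
  "refines P cs \<longleftrightarrow> (\<forall>C\<in>P. \<exists>c\<in>set cs. C \<subseteq> set c)"

text \<open>Mapping each block to the cluster around it is onto, as the clusters are nonempty and
  covered by blocks. With at least as many clusters as blocks it is also injective, so each cluster
  is a single block. This shows that counting splits suffices for termination.\<close>

lemma refines_card:
  assumes cs: "clustering n cs" and P: "partition_on {..<n} P" and ref: "refines P cs"
    and len: "card P \<le> length cs"
  shows "set ` set cs = P"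
proof -
  have finP: "finite P" using finite_elements[OF _ P] by simp
  have "\<forall>C\<in>P. \<exists>c. c \<in> set cs \<and> C \<subseteq> set c" using ref unfolding refines_def by blast
  from bchoice[OF this] obtain f where f: "\<And>C. C \<in> P \<Longrightarrow> f C \<in> set cs \<and> C \<subseteq> set (f C)" by blast
  have uniq: "f C = c" if "C \<in> P" "c \<in> set cs" "x \<in> C" "x \<in> set c" for C c x
    using clustering_distinct(3)[OF cs, of "f C" c] f that by blast
  have cover: "\<exists>C\<in>P. x \<in> C \<and> f C = c" if "c \<in> set cs" "x \<in> set c" for c x
  proof -
    have "x \<in> {..<n}" using that cs by (auto simp: clustering_def)
    then obtain C where "C \<in> P" "x \<in> C" using partition_onD1[OF P] by auto
    then show ?thesis using uniq that by blast
  qed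
  have surj: "f ` P = set cs"
  proof
    show "set cs \<subseteq> f ` P"
    proof
      fix c assume c: "c \<in> set cs"
      then have "c \<noteq> []" using cs unfolding clustering_def by blast
      then obtain x where "x \<in> set c" using list.set_sel(1) by blast
      then show "c \<in> f ` P" using cover[OF c] by blast
    qed
  qed (use f in auto)
  have "card P \<le> card (f ` P)" unfolding surj using len distinct_card[OF clustering_distinct(1)[OF cs]] by simp
  then have inj: "inj_on f P" using finP card_image_le[OF finP, of f] by (intro eq_card_imp_inj_on) auto
  have eq: "set (f C) = C" if C: "C \<in> P" for C
  proof
    show "set (f C) \<subseteq> C"
    proof
      fix x assume "x \<in> set (f C)"
      then obtain D where "D \<in> P" "x \<in> D" "f D = f C" using cover f[OF C] by blast
      then show "x \<in> C" using inj C by (auto dest: inj_onD)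
    qed
  qed (use f[OF C] in auto)
  have "set ` set cs = set ` f ` P" using surj by simp
  also have "\<dots> = P" using eq by (auto simp: image_image)
  finally show ?thesis .
qed

lemma length_split_ge: "length cs \<le> length (split_all w r cs)"
  by (induction cs) (auto simp: split_cluster_def)

lemma length_split_gt:
  "c \<in> set cs \<Longrightarrow> length (split_cluster w r c) = 2 \<Longrightarrow> length cs < length (split_all w r cs)"
proof (induction cs)
  case (Cons a cs)
  have "1 \<le> length (split_cluster w r a)" by (simp add: split_cluster_def)
  then show ?case using Cons length_split_ge[of cs w r] by auto
qed simp

text \<open>Only a cluster containing the centre \<open>u\<close> can be split, and by disjointness
  there is at most one.\<close>

lemma length_split_le:
  assumes "distinct (concat cs)" "\<And>x. x \<in> set (concat cs) \<Longrightarrow> \<not> 0 < w ! x \<Longrightarrow> x = u"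
  shows "length (split_all w r cs) \<le> length cs + 1"
proof -
  have same: "u \<notin> set (concat cs) \<Longrightarrow> (\<And>x. x \<in> set (concat cs) \<Longrightarrow> \<not> 0 < w ! x \<Longrightarrow> x = u)
      \<Longrightarrow> length (split_all w r cs) = length cs" for cs
    by (induction cs) (auto simp: split_cluster_def)
  show ?thesis using assms
  proof (induction cs)
    case (Cons c cs)
    show ?case
    proof (cases "u \<in> set c")
      case True
      then have "length (split_all w r cs) = length cs"
        using Cons.prems by (intro same) auto
      then show ?thesis by (auto simp: split_cluster_def)
    next
      case False
      then have "split_cluster w r c = [c]" using Cons.prems by (auto simp: split_cluster_def)
      then show ?thesis using Cons by simp
    qed
  qed simp
qed

lemma split_noop:
  assumes "\<And>x. x \<in> set (concat cs) \<Longrightarrow> w ! x \<le> r"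
  shows "set (split_all w r cs) = set cs"
proof -
  have "split_cluster w r c = [c]" if "c \<in> set cs" for c
    using assms that unfolding split_cluster_def by (auto simp: not_less[symmetric])
  then show ?thesis unfolding set_split by auto
qed

text \<open>Some cluster is not a block and is therefore a union of at least two blocks. A ball
  separating these cuts no block inside it, and the other clusters miss the centre and stay as they
  are.\<close>

lemma split_progress:
  assumes met: "Metric_space {..<n} d" and P: "partition_on {..<n} P"
    and sep: "\<And>J. J \<subseteq> P \<Longrightarrow> 2 \<le> card J \<Longrightarrow> (\<Sum>C\<in>J. diam d C) < diam d (\<Union>J)"
    and cs: "clustering n cs" and ref: "refines P cs" and ne: "set ` set cs \<noteq> P"
  shows "\<exists>w\<in>set (matrix_rows n d). \<exists>r\<in>set w. refines P (split_all w r cs) \<and> length cs < length (split_all w r cs)"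
proof -
  have finP: "finite P" using finite_elements[OF _ P] by simp
  have Pprop: "finite C \<and> C \<noteq> {} \<and> C \<subseteq> {..<n}" if "C \<in> P" for C
    using partition_onD1[OF P] partition_onD3[OF P] that by (auto intro: finite_subset[of C "{..<n}"])
  have "\<not> set ` set cs \<subseteq> P"
  proof
    assume sub: "set ` set cs \<subseteq> P"
    have "C \<in> set ` set cs" if C: "C \<in> P" for C
    proof -
      obtain c where c: "c \<in> set cs" "C \<subseteq> set c" using ref C unfolding refines_def by blast
      have "C = set c"
      proof (rule ccontr)
        assume "C \<noteq> set c"
        then have "C \<inter> set c = {}" using c sub C disjointD[OF partition_onD2[OF P]] by blast
        then show False using c Pprop[OF C] by auto
      qed
      then show ?thesis using c by blast
    qed
    then show False using sub ne by blast
  qed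
  then obtain c where c: "c \<in> set cs" "set c \<notin> P" by blast
  have cn: "\<forall>x\<in>set c. x < n" using clustering_member[OF cs c(1)] by simp
  define J where "J = {C \<in> P. C \<subseteq> set c}"
  have UJ: "\<Union>J = set c"
  proof
    show "set c \<subseteq> \<Union>J"
    proof
      fix x assume x: "x \<in> set c"
      then have "x \<in> {..<n}" using cn by simp
      then obtain C where C: "C \<in> P" "x \<in> C" using partition_onD1[OF P] by auto
      obtain c' where c': "c' \<in> set cs" "C \<subseteq> set c'" using ref C unfolding refines_def by blast
      then have "c' = c" using clustering_distinct(3)[OF cs c'(1) c(1)] x C by blast
      then show "x \<in> \<Union>J" using c' C unfolding J_def by blast
    qed
  qed (auto simp: J_def)
  have JP: "J \<subseteq> P" and finJ: "finite J" using finP by (auto simp: J_def)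
  have cne: "set c \<noteq> {}" using c cs by (auto simp: clustering_def)
  then have Jne: "J \<noteq> {}" using UJ by auto
  have "card J \<noteq> 1"
  proof
    assume "card J = 1"
    then obtain C where "J = {C}" by (auto simp: card_1_singleton_iff)
    then show False using UJ c JP by auto
  qed
  moreover have "card J \<noteq> 0" using finJ Jne by simp
  ultimately have "2 \<le> card J" by simp
  then have less: "(\<Sum>C\<in>J. diam d C) < diam d (\<Union>J)" by (rule sep[OF JP])
  obtain u v z where u: "u \<in> \<Union>J" "z \<in> \<Union>J" "v \<in> \<Union>J" "d u z < d u v"
    and side: "\<And>C. C \<in> J \<Longrightarrow> (\<forall>x\<in>C. d u x \<le> d u z) \<or> (\<forall>x\<in>C. d u z < d u x)"
    by (rule separating_ball[OF met finJ _ less Jne]) (use Pprop JP in blast)+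
  define w where "w = matrix_rows n d ! u"
  define r where "r = d u z"
  have un: "u < n" "z < n" "v < n" using u UJ cn by auto
  have w: "w ! x = d u x" if "x < n" for x unfolding w_def using un that by (simp add: rows_nth)
  have wM: "w \<in> set (matrix_rows n d)" "r \<in> set w"
    using un unfolding w_def r_def by (auto simp: matrix_rows_def)
  have uu: "w ! u = 0" using w un Metric_space.zero[OF met, of u u] by simp
  have split_c: "split_cluster w r c = [rev [x\<leftarrow>c. \<not> r < w ! x], rev [x\<leftarrow>c. r < w ! x]]"
  proof -
    have "u \<in> set c" "v \<in> set c" "r < w ! v" using u UJ w un r_def by auto
    then show ?thesis unfolding split_cluster_def using uu by (auto intro: bexI[of _ u])
  qed
  have "refines P (split_all w r cs)" unfolding refines_def
  proof
    fix C assume C: "C \<in> P"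
    then obtain c' where c': "c' \<in> set cs" "C \<subseteq> set c'" using ref unfolding refines_def by blast
    show "\<exists>a\<in>set (split_all w r cs). C \<subseteq> set a"
    proof (cases "c' = c")
      case True
      then have CJ: "C \<in> J" using C c' unfolding J_def by simp
      have lt: "\<And>x. x \<in> C \<Longrightarrow> x < n \<and> x \<in> set c" using c' True cn by auto
      have "C \<subseteq> set (rev [x\<leftarrow>c. \<not> r < w ! x]) \<or> C \<subseteq> set (rev [x\<leftarrow>c. r < w ! x])"
        using side[OF CJ] lt w unfolding r_def by force
      then have "\<exists>a\<in>set (split_cluster w r c). C \<subseteq> set a" unfolding split_c by simp
      then show ?thesis unfolding set_split using c(1) by blast
    next
      case False
      have "u \<notin> set c'" using clustering_distinct(3)[OF cs c'(1) c(1) False] u UJ by auto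
      then have "0 < w ! x" if "x \<in> set c'" for x
        using that clustering_member(1)[OF cs c'(1)] w[of x] un
          Metric_space.zero[OF met, of u x] Metric_space.nonneg[OF met, of u x] by fastforce
      then have "split_cluster w r c' = [c']" unfolding split_cluster_def by auto
      then show ?thesis unfolding set_split using c' by (auto intro!: bexI[of _ c'])
    qed
  qed
  moreover have "length cs < length (split_all w r cs)"
    using c split_c by (intro length_split_gt) auto
  ultimately show ?thesis using wM by blast
qed

text \<open>Only \<open>k0 - 1\<close> of the levels are effective, hence the minimum. A clustering
  coarser than \<open>P\<close> has gained a cluster in each effective level unless it has become
  \<open>P\<close>.\<close>

definition reaches :: "nat \<Rightarrow> nat set set \<Rightarrow> nat \<Rightarrow> nat \<Rightarrow> nat \<times> nat list list list \<Rightarrow> bool" where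
  "reaches n P k0 t = (\<lambda>(k, L). k = k0 - min t (k0 - 1) \<and>
     (\<exists>cs\<in>set L. clustering n cs \<and> refines P cs \<and>
       (set ` set cs = P \<or> min t (k0 - 1) + 1 \<le> length cs)))"

lemma reaches_level:
  assumes met: "Metric_space {..<n} d" and P: "partition_on {..<n} P"
    and sep: "\<And>J. J \<subseteq> P \<Longrightarrow> 2 \<le> card J \<Longrightarrow> (\<Sum>C\<in>J. diam d C) < diam d (\<Union>J)"
    and n: "1 \<le> n" and k0: "1 \<le> k0" and a: "reaches n P k0 t a"
  shows "reaches n P k0 (Suc t) (level (matrix_rows n d) w a)"
proof -
  obtain k L where kL: "a = (k, L)" by (cases a)
  from a kL obtain cs where k: "k = k0 - min t (k0 - 1)" and cs: "cs \<in> set L" "clustering n cs"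
    "refines P cs" "set ` set cs = P \<or> min t (k0 - 1) + 1 \<le> length cs"
    unfolding reaches_def by blast
  show ?thesis
  proof (cases "1 < k")
    case False
    then have "min (Suc t) (k0 - 1) = min t (k0 - 1)" using k k0 by (simp add: min_def split: if_splits)
    then show ?thesis using a False kL unfolding reaches_def level_def by simp
  next
    case True
    then have t: "t < k0 - 1" using k k0 by (simp add: min_def split: if_splits)
    have nonneg: "0 \<le> r" if "w \<in> set (matrix_rows n d)" "r \<in> set w" for w r
      using good_matrix_rows[OF met] that unfolding good_matrix_def by blast
    have "\<exists>w\<in>set (matrix_rows n d). \<exists>r\<in>set w. refines P (split_all w r cs) \<and>
       (set ` set (split_all w r cs) = P \<or> set ` set cs \<noteq> P \<and> length cs < length (split_all w r cs))"
    proof (cases "set ` set cs = P")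
      case True
      \<comment> \<open>A solution found early must survive the remaining rounds, but
        \<open>expand\<close> offers only splits. With the largest entry of a row as radius nothing
        lies outside the ball, and the clusters stay the same.\<close>
      let ?w = "matrix_rows n d ! 0"
      have len: "length ?w = n" using n by (simp add: matrix_rows_def)
      have w: "?w \<in> set (matrix_rows n d)" using n by (intro nth_mem) (simp add: matrix_rows_def)
      have r: "Max (set ?w) \<in> set ?w" using n len by (intro Max_in) auto
      have "set (split_all ?w (Max (set ?w)) cs) = set cs"
      proof (rule split_noop)
        fix x assume "x \<in> set (concat cs)"
        then have "x < length ?w" using cs(2) len by (auto simp: clustering_def)
        then show "?w ! x \<le> Max (set ?w)" by (intro Max_ge) auto
      qed
      then show ?thesis using w r True cs(3) unfolding refines_def by metis
    next
      case False
      show ?thesis using split_progress[OF met P sep cs(2,3) False] False by blast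
    qed
    then obtain w' r where w': "w' \<in> set (matrix_rows n d)" "r \<in> set w'" "refines P (split_all w' r cs)"
      "set ` set (split_all w' r cs) = P \<or> set ` set cs \<noteq> P \<and> length cs < length (split_all w' r cs)" by blast
    have "split_all w' r cs \<in> set (expand (matrix_rows n d) L)" using w' cs unfolding set_expand by blast
    moreover have "clustering n (split_all w' r cs)" using clustering_split[OF cs(2) nonneg[OF w'(1,2)]] .
    moreover have "set ` set (split_all w' r cs) = P \<or> min (Suc t) (k0 - 1) + 1 \<le> length (split_all w' r cs)"
      using w'(4) cs(4) t by auto
    ultimately show ?thesis unfolding kL reaches_def level_def using True t k w'(3) by auto
  qed
qed

lemma candidates_complete:
  assumes met: "Metric_space {..<n} d" and P: "partition_on {..<n} P"
    and sep: "\<And>J. J \<subseteq> P \<Longrightarrow> 2 \<le> card J \<Longrightarrow> (\<Sum>C\<in>J. diam d C) < diam d (\<Union>J)"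
    and n: "1 \<le> n" and k: "1 \<le> k" "card P \<le> k"
  shows "\<exists>cs\<in>set (candidates (matrix_rows n d) k). set ` set cs = P"
proof -
  have Pprop: "C \<noteq> {} \<and> C \<subseteq> {..<n}" if "C \<in> P" for C
    using partition_onD1[OF P] partition_onD3[OF P] that by auto
  have step: "reaches n P k t a \<Longrightarrow> reaches n P k (t + length ws) (fold (level (matrix_rows n d)) ws a)" for t a ws
  proof (induction ws arbitrary: t a)
    case (Cons w ws)
    have "reaches n P k (Suc t) (level (matrix_rows n d) w a)" by (rule reaches_level[OF met P sep n k(1) Cons.prems])
    from Cons.IH[OF this] show ?case by simp
  qed simp
  have "refines P [rev [0..<n]]" unfolding refines_def using Pprop by fastforce
  moreover have "clustering n [rev [0..<n]]"
    using level_inv_init[OF n k(1)] by (simp add: level_inv_def)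
  ultimately have "reaches n P k 0 (k, [[rev [0..<n]]])" unfolding reaches_def by simp
  from step[OF this, of "matrix_rows n d"]
  have "reaches n P k n (fold (level (matrix_rows n d)) (matrix_rows n d) (k, [[rev [0..<n]]]))"
    by (simp add: matrix_rows_def)
  then obtain cs where cs: "cs \<in> set (candidates (matrix_rows n d) k)" "clustering n cs" "refines P cs"
     "set ` set cs = P \<or> min n (k - 1) + 1 \<le> length cs"
    unfolding reaches_def candidates_def by (auto simp: matrix_rows_def)
  have "set ` set cs = P"
  proof (rule ccontr)
    assume ne: "set ` set cs \<noteq> P"
    then have "min n (k - 1) + 1 \<le> length cs" using cs by blast
    \<comment> \<open>If the minimum were \<open>n\<close>, there would be \<open>n + 1\<close>
      nonempty clusters on \<open>n\<close> points; so it is \<open>k - 1\<close>, and there are at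
      least \<open>k\<close> clusters.\<close>
    then have "card P \<le> length cs" using clustering_length[OF cs(2)] k by (simp add: min_def split: if_splits)
    then show False using refines_card[OF cs(2) P cs(3)] ne by blast
  qed
  then show ?thesis using cs by blast
qed

text \<open>An effective round adds at most one cluster and lowers the counter by one. As the
  counter ends at 1 or above, at most \<open>k0\<close> clusters result, so the program never has to
  test the number of clusters.\<close>

definition short :: "nat \<Rightarrow> nat \<Rightarrow> nat \<times> nat list list list \<Rightarrow> bool" where
  "short n k0 = (\<lambda>(k, L). 1 \<le> k \<and> (\<forall>cs\<in>set L. clustering n cs \<and> length cs + k \<le> k0 + 1))"

lemma short_level:
  assumes met: "Metric_space {..<n} d" and a: "short n k0 a"
  shows "short n k0 (level (matrix_rows n d) w a)"
proof -
  obtain k L where kL: "a = (k, L)" by (cases a)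
  have split: "clustering n (split_all w r cs) \<and> length (split_all w r cs) \<le> length cs + 1"
    if cs: "clustering n cs" and w: "w \<in> set (matrix_rows n d)" "r \<in> set w" for cs w r
  proof
    have "0 \<le> r" using good_matrix_rows[OF met] w unfolding good_matrix_def by blast
    then show "clustering n (split_all w r cs)" by (rule clustering_split[OF cs])
    obtain u where u: "u < n" "w = matrix_rows n d ! u" using w by (auto simp: in_set_conv_nth matrix_rows_def)
    show "length (split_all w r cs) \<le> length cs + 1"
    proof (rule length_split_le)
      show "distinct (concat cs)" using cs by (simp add: clustering_def)
      fix x assume "x \<in> set (concat cs)" "\<not> 0 < w ! x"
      moreover from this have "x < n" using cs by (auto simp: clustering_def)
      ultimately have "x < n" "\<not> 0 < d u x" using u by (simp_all add: rows_nth)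
      then show "x = u" using Metric_space.zero[OF met, of u x] Metric_space.nonneg[OF met, of u x] u
        by fastforce
    qed
  qed
  have L: "1 \<le> k" "\<And>cs. cs \<in> set L \<Longrightarrow> clustering n cs \<and> length cs + k \<le> k0 + 1"
    using a unfolding kL short_def by auto
  show ?thesis
  proof (cases "1 < k")
    case True
    have "clustering n cs' \<and> length cs' + (k - 1) \<le> k0 + 1" if cs': "cs' \<in> set (expand (matrix_rows n d) L)" for cs'
    proof -
      obtain cs w r where *: "cs' = split_all w r cs" "cs \<in> set L" "w \<in> set (matrix_rows n d)" "r \<in> set w"
        using cs' unfolding set_expand by blast
      show ?thesis using split[of cs w r] L(2)[OF *(2)] * True by auto
    qed
    then show ?thesis using True unfolding kL short_def level_def by simp
  next
    case False
    then show ?thesis using L unfolding kL short_def level_def by simp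
  qed
qed

lemma candidates_short:
  assumes met: "Metric_space {..<n} d" and n: "1 \<le> n" and k: "1 \<le> k"
    and cs: "cs \<in> set (candidates (matrix_rows n d) k)"
  shows "length cs \<le> k"
proof -
  have step: "short n k a \<Longrightarrow> short n k (fold (level (matrix_rows n d)) ws a)" for a ws
  proof (induction ws arbitrary: a)
    case (Cons w ws)
    show ?case unfolding fold_simps by (rule Cons.IH[OF short_level[OF met Cons.prems]])
  qed simp
  have "clustering n [rev [0..<n]]"
    using level_inv_init[OF n k] by (simp add: level_inv_def)
  then have "short n k (k, [[rev [0..<n]]])" using k by (simp add: short_def)
  from step[OF this, of "matrix_rows n d"] cs show ?thesis
    unfolding candidates_def short_def by (fastforce simp: matrix_rows_def split: prod.splits)
qed

lemma best_spec:
  "case best M ok L of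
     None \<Rightarrow> \<forall>cs\<in>set L. \<not> ok cs
   | Some (r, cs) \<Rightarrow> cs \<in> set L \<and> ok cs \<and> (\<forall>cs'\<in>set L. ok cs' \<longrightarrow> cost_of_lists M cs \<le> cost_of_lists M cs')"
proof -
  \<comment> \<open>\<open>S\<close> collects the candidates processed so far. The stored
    \<open>r\<close> must be the cost of the stored clustering, since the next comparison reads only
    \<open>r\<close>.\<close>
  define R where "R S b \<longleftrightarrow> (case b of None \<Rightarrow> \<forall>cs\<in>S. \<not> ok cs
     | Some (r, cs) \<Rightarrow> cs \<in> S \<and> ok cs \<and> r = cost_of_lists M cs \<and> (\<forall>cs'\<in>S. ok cs' \<longrightarrow> cost_of_lists M cs \<le> cost_of_lists M cs'))"
    for S b
  have step: "R (insert cs S) (better M ok cs b)" if "R S b" for S b cs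
    using that unfolding R_def better_def by (cases b) (auto split: if_splits)
  have "R S b \<Longrightarrow> R (S \<union> set L) (fold (better M ok) L b)" for S b
  proof (induction L arbitrary: S b)
    case (Cons cs L)
    from Cons.IH[OF step[OF Cons.prems]] show ?case by simp
  qed simp
  from this[of "{}" None] have "R (set L) (best M ok L)" by (simp add: R_def best_def)
  then show ?thesis unfolding R_def by (auto split: option.splits)
qed

lemma finite_partitions: "finite A \<Longrightarrow> finite {P. partition_on A P}"
  by (rule finite_subset[of _ "Pow (Pow A)"]) (auto dest: partition_onD1)

text \<open>Minimize the cost first, then the number of clusters. A feasible \<open>Q\<close> with
  fewer clusters meets the bound \<open>k\<close> automatically, so it is no cheaper, and equal cost
  would contradict the second minimization.\<close>

lemma optimal_solution_fewest:
  assumes I: "valid_instance I" and ex: "feasible_solution I k P0"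
  obtains P where "optimal_solution I k P"
    "\<And>Q. Q \<in> feasible I \<Longrightarrow> card Q < card P \<Longrightarrow> cost I P < cost I Q"
proof -
  let ?S = "{P. feasible_solution I k P}"
  have "?S \<subseteq> {P. partition_on (points I) P}"
    using I unfolding valid_instance_def feasible_solution_def by blast
  then have fin: "finite ?S"
    using finite_partitions[of "points I"] finite_subset unfolding points_def by blast
  define c where "c = Min (cost I ` ?S)"
  have le: "c \<le> cost I Q" if "feasible_solution I k Q" for Q
    unfolding c_def using fin that by (intro Min_le) auto
  have "c \<in> cost I ` ?S" unfolding c_def using fin ex by (intro Min_in) auto
  then have "\<exists>P. feasible_solution I k P \<and> cost I P = c" by auto
  from ex_has_least_nat[of "\<lambda>P. feasible_solution I k P \<and> cost I P = c" _ card] this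
  obtain P where P: "feasible_solution I k P" "cost I P = c"
    "\<And>Q. feasible_solution I k Q \<Longrightarrow> cost I Q = c \<Longrightarrow> card P \<le> card Q" by blast
  show ?thesis
  proof (rule that)
    show "optimal_solution I k P" unfolding optimal_solution_def using P le by auto
    fix Q assume Q: "Q \<in> feasible I" "card Q < card P"
    then have f: "feasible_solution I k Q" using P unfolding feasible_solution_def by auto
    then have "cost I Q \<noteq> c" using P(3) Q by fastforce
    then show "cost I P < cost I Q" using le[OF f] P(2) by simp
  qed
qed

text \<open>Some optimum with the fewest clusters is among the candidates whenever a solution
  exists. The clustering returned may be another one, but it is feasible and costs no more.\<close>

lemma search_correct:
  assumes I: "valid_instance I" "mergeable I" and k: "1 \<le> k"
  shows "correct_output I k
    (case best (matrix_rows (num_points I) (distance I)) (\<lambda>cs. set ` set cs \<in> feasible I)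
       (candidates (matrix_rows (num_points I) (distance I)) k) of
       None \<Rightarrow> Null | Some (r, cs) \<Rightarrow> clusters_val cs)"
proof -
  define n where "n = num_points I"
  define M where "M = matrix_rows n (distance I)"
  define L where "L = candidates M k"
  define ok where "ok cs \<longleftrightarrow> set ` set cs \<in> feasible I" for cs :: "nat list list"
  have n: "1 \<le> n" and met': "Metric_space (points I) (distance I)"
    and part: "\<And>P. P \<in> feasible I \<Longrightarrow> partition_on {..<n} P"
    using I unfolding valid_instance_def n_def points_def by auto
  have met: "Metric_space {..<n} (distance I)" using met' by (simp add: points_def n_def)
  have good: "good_matrix n M" unfolding M_def by (rule good_matrix_rows[OF met])
  have cl: "clustering n cs" if "cs \<in> set L" for cs
    using candidates_inv(1)[OF good n k] that unfolding L_def by blast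
  have cost: "cost_of_lists M cs = cost I (set ` set cs)" if "cs \<in> set L" for cs
    unfolding M_def n_def by (rule total_rows[OF _ met']) (use cl[OF that] n_def in simp)
  have feas: "feasible_solution I k (set ` set cs)" if "cs \<in> set L" "ok cs" for cs
    using that candidates_short[OF met n k, of cs] clustering_card[OF cl[OF that(1)]]
    unfolding feasible_solution_def ok_def L_def M_def by simp
  have opt: "\<exists>cs\<in>set L. ok cs \<and> optimal_solution I k (set ` set cs)" if ex: "\<exists>P. feasible_solution I k P"
  proof -
    from ex obtain P0 where "feasible_solution I k P0" by blast
    from optimal_solution_fewest[OF I(1) this] obtain P where P: "optimal_solution I k P"
      "\<And>Q. Q \<in> feasible I \<Longrightarrow> card Q < card P \<Longrightarrow> cost I P < cost I Q" by blast
    then have Pf: "P \<in> feasible I" "card P \<le> k"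
      unfolding optimal_solution_def feasible_solution_def by auto
    have "finite P" using finite_elements[OF _ part[OF Pf(1)]] by simp
    from sum_diam_less_diam_Union[OF I Pf(1) this P(2)]
    have "\<exists>cs\<in>set L. set ` set cs = P" unfolding L_def M_def
      by (intro candidates_complete[OF met part[OF Pf(1)] _ n k Pf(2)]) blast+
    then show ?thesis using P(1) Pf unfolding ok_def by blast
  qed
  note spec = best_spec[where M = M and ok = ok and L = L]
  have "correct_output I k (case best M ok L of None \<Rightarrow> Null | Some (r, cs) \<Rightarrow> clusters_val cs)"
  proof (cases "best M ok L")
    case None
    then have "\<forall>cs\<in>set L. \<not> ok cs" using spec by simp
    then have "\<not> (\<exists>P. feasible_solution I k P)" using opt by blast
    then show ?thesis unfolding correct_output_def None by auto
  next
    case (Some rc)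
    obtain r cs where rc: "rc = (r, cs)" by (cases rc)
    then have cs: "cs \<in> set L" "ok cs" "\<And>cs'. cs' \<in> set L \<Longrightarrow> ok cs' \<Longrightarrow> cost_of_lists M cs \<le> cost_of_lists M cs'"
      using spec Some by auto
    have ex: "\<exists>P. feasible_solution I k P" using feas[OF cs(1,2)] by blast
    from opt[OF this] obtain cs' where cs': "cs' \<in> set L" "ok cs'" "optimal_solution I k (set ` set cs')" by blast
    have "cost I (set ` set cs) \<le> cost I (set ` set cs')"
      using cs(3)[OF cs'(1,2)] cost[OF cs(1)] cost[OF cs'(1)] by simp
    then have "optimal_solution I k (set ` set cs)"
      using feas[OF cs(1,2)] cs'(3) unfolding optimal_solution_def by (meson order_trans)
    then show ?thesis unfolding correct_output_def Some rc
      using ex clustering_partition(2)[OF cl[OF cs(1)]] by auto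
  qed
  then show ?thesis unfolding L_def M_def n_def ok_def[abs_def] .
qed

lemma search_solves:
  assumes I: "I \<in> \<P>" "mergeable_msd_problem \<P>" and p: "checks_feasibility p f \<P>" and k: "1 \<le> k"
  defines "n \<equiv> num_points I"
  shows "solves_within (search_prog p) I k (1200 * (n ^ (2 * (k - 1)) * n ^ 6 * f n))"
proof -
  have valid: "valid_instance I" "mergeable I" using I unfolding mergeable_msd_problem_def by auto
  have n: "1 \<le> n" and met: "Metric_space (points I) (distance I)"
    using valid unfolding valid_instance_def n_def by auto
  define M where "M = matrix_rows n (distance I)"
  have inst: "instance_vals I = [nat_val n, rows_val M, side_info I]"
    by (simp add: instance_vals_def n_def M_def matrix_val_eq)
  have run: "\<exists>t\<le>f n. run [list_val [nat_val n, rows_val M, side_info I, clusters_val cs]] p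
      (truth (set ` set cs \<in> feasible I)) t" if "clustering n cs" for cs
  proof -
    have "\<exists>t\<le>f (num_points I). run [list_val (instance_vals I @ [clusters_val cs])] p
      (truth (set ` set cs \<in> feasible I)) t"
      using p[unfolded checks_feasibility_def, rule_format, OF I(1), of "set ` set cs" cs]
        clustering_partition[OF that] by (simp add: points_def n_def)
    then show ?thesis unfolding inst by (simp add: n_def)
  qed
  \<comment> \<open>The one-cluster partition is an admissible input of the checker, whose halting
    on it gives \<open>1 \<le> f n\<close>.\<close>
  have "clustering n [rev [0..<n]]"
    using level_inv_init[OF n k] by (simp add: level_inv_def)
  from run[OF this] have F: "1 \<le> f n" using run_time_pos le_trans by blast
  have "ev [list_val [nat_val n, rows_val M, side_info I, nat_val k]] (search_prog p)
    (case best M (\<lambda>cs. set ` set cs \<in> feasible I) (candidates M k) of None \<Rightarrow> Null | Some (r, cs) \<Rightarrow> clusters_val cs)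
    (1200 * (n ^ (2 * (k - 1)) * n ^ 6 * f n))"
    by (rule ev_search[OF _ n k F]) (use run good_matrix_rows[OF met] M_def in \<open>auto simp: ev_def\<close>)
  then show ?thesis
    using search_correct[OF valid k] unfolding solves_within_def ev_def inst M_def n_def by auto
qed

section \<open>Fair clustering\<close>

text \<open>If one colour is missing, the other count is positive and both sides say
  \<open>b = 0\<close>; otherwise multiply out. The inequalities add up over disjoint unions, which
  gives mergeability, and they spare the checker a division that would be stuck at 0.\<close>

lemma balanced_iff:
  assumes C: "finite C" "C \<noteq> {}" "C \<subseteq> X1 \<union> X2" and b: "0 \<le> b"
  shows "balanced X1 X2 b C \<longleftrightarrow>
    b * real (card (C \<inter> X1)) \<le> real (card (C \<inter> X2)) \<and> b * real (card (C \<inter> X2)) \<le> real (card (C \<inter> X1))"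
proof (cases "card (C \<inter> X1) = 0 \<or> card (C \<inter> X2) = 0")
  case True
  have "card (C \<inter> X1) \<noteq> 0 \<or> card (C \<inter> X2) \<noteq> 0" using C by auto
  with True b show ?thesis unfolding balanced_def
    by (auto simp: mult_le_0_iff)
next
  case False
  then have "0 < real (card (C \<inter> X1))" "0 < real (card (C \<inter> X2))" by auto
  then show ?thesis unfolding balanced_def by (simp add: pos_le_divide_eq)
qed

lemma mergeable_fair: "mergeable_msd_problem fair_msd"
  unfolding mergeable_msd_problem_def
proof
  fix I assume "I \<in> fair_msd"
  then obtain n d X1 X2 b where I: "I = fair_instance n d X1 X2 b" and n: "1 \<le> n"
    and met: "Metric_space {..<n} d" and X: "X1 \<union> X2 = {..<n}" "X1 \<inter> X2 = {}" and b: "0 \<le> b" "b \<le> 1"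
    unfolding fair_msd_def by blast
  have feas: "feasible I = {P. partition_on {..<n} P \<and> (\<forall>C\<in>P. balanced X1 X2 b C)}"
    by (simp add: I fair_instance_def)
  have "valid_instance I" using n met
    by (auto simp: valid_instance_def I fair_instance_def points_def)
  moreover have "mergeable I" unfolding mergeable_def
  proof (intro ballI impI)
    fix P A B assume P: "P \<in> feasible I" and AB: "A \<in> P" "B \<in> P" "A \<noteq> B"
    have part: "partition_on {..<n} P" and bal: "\<And>C. C \<in> P \<Longrightarrow> balanced X1 X2 b C"
      using P unfolding feas by auto
    have fin: "finite C \<and> C \<noteq> {} \<and> C \<subseteq> X1 \<union> X2" if "C \<in> P" for C
      using partition_onD1[OF part] partition_onD3[OF part] that X(1)
      by (auto intro: finite_subset[of C "{..<n}"])
    have AB0: "A \<inter> B = {}" using disjointD[OF partition_onD2[OF part] AB] .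
    have "partition_on {..<n} (insert (A \<union> B) (P - {A, B}))"
    proof (rule partition_onI)
      show "\<Union>(insert (A \<union> B) (P - {A, B})) = {..<n}" using partition_onD1[OF part] AB by auto
      show "{} \<notin> insert (A \<union> B) (P - {A, B})" using fin AB by auto
      have dis: "C \<inter> D = {}" if "C \<in> P" "D \<in> P" "C \<noteq> D" for C D
        using disjointD[OF partition_onD2[OF part] that] .
      fix p q assume pq: "p \<in> insert (A \<union> B) (P - {A, B})" "q \<in> insert (A \<union> B) (P - {A, B})" "p \<noteq> q"
      have "C \<inter> (A \<union> B) = {}" if "C \<in> P - {A, B}" for C
        using dis[of C A] dis[of C B] that AB by auto
      then show "disjnt p q" using pq dis[of p q] unfolding disjnt_def by blast
    qed
    moreover have "balanced X1 X2 b (A \<union> B)"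
    proof -
      have card: "card ((A \<union> B) \<inter> Y) = card (A \<inter> Y) + card (B \<inter> Y)" for Y
      proof -
        have "(A \<union> B) \<inter> Y = (A \<inter> Y) \<union> (B \<inter> Y)" by auto
        also have "card \<dots> = card (A \<inter> Y) + card (B \<inter> Y)"
          using fin AB AB0 by (intro card_Un_disjoint) auto
        finally show ?thesis .
      qed
      have "balanced X1 X2 b A" "balanced X1 X2 b B" using bal AB by auto
      then show ?thesis
        using fin[OF AB(1)] fin[OF AB(2)] b balanced_iff[of A X1 X2 b] balanced_iff[of B X1 X2 b]
          balanced_iff[of "A \<union> B" X1 X2 b]
        by (simp add: card distrib_left)
    qed
    ultimately show "insert (A \<union> B) (P - {A, B}) \<in> feasible I"
      using bal unfolding feas by auto
  qed
  ultimately show "valid_instance I \<and> mergeable I" ..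
qed

text \<open>Variables: 0 is a cluster, 1 the list of colours (1 or 2) of all points.\<close>

definition count_prog :: prog where
  "count_prog = Fold (Var 0) (Op2 MkCell (Const 0) (Const 0))
     (Bind (Bind (Var 4) (Bind (Var 2) nth_prog))
       (Ite (Op2 Less (Var 0) (Const 2))
         (Op2 MkCell (Op2 Plus (Op1 Fst (Var 1)) (Const 1)) (Op1 Snd (Var 1)))
         (Op2 MkCell (Op1 Fst (Var 1)) (Op2 Plus (Op1 Snd (Var 1)) (Const 1)))))"

lemma ev_count:
  assumes c: "length c \<le> n" "\<forall>x\<in>set c. x < n" "distinct c"
    and X: "set c \<subseteq> X1 \<union> X2" "X1 \<inter> X2 = {}" and n: "1 \<le> n"
  shows "ev (cluster_val c # row_val (map (\<lambda>i. if i \<in> X1 then 1 else 2) [0..<n]) # E) count_prog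
    (Cell (Num (real (card (set c \<inter> X1)))) (Num (real (card (set c \<inter> X2))))) (150 * n ^ 2)"
proof -
  define w :: "real list" where "w = map (\<lambda>i. if i \<in> X1 then 1 else 2) [0..<n]"
  have w: "length w = n" "\<And>x. x < n \<Longrightarrow> w ! x = (if x \<in> X1 then 1 else 2)" by (auto simp: w_def)
  define ea :: "nat \<times> nat \<Rightarrow> val" where "ea = (\<lambda>(i, j). Cell (Num (real i)) (Num (real j)))"
  define g :: "nat \<Rightarrow> nat \<times> nat \<Rightarrow> nat \<times> nat"
    where "g = (\<lambda>x (i, j). if x \<in> X1 then (i + 1, j) else (i, j + 1))"
  have "fold g c (i, j) = (i + length [x\<leftarrow>c. x \<in> X1], j + length [x\<leftarrow>c. x \<notin> X1])" for i j
    by (induction c arbitrary: i j) (auto simp: g_def)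
  moreover have "length [x\<leftarrow>c. x \<in> X1] = card (set c \<inter> X1)"
    using distinct_card[of "[x\<leftarrow>c. x \<in> X1]"] c(3) by (simp add: Int_def)
  moreover have "length [x\<leftarrow>c. x \<notin> X1] = card (set c \<inter> X2)"
  proof -
    have "{x \<in> set c. x \<notin> X1} = set c \<inter> X2" using X by auto
    then show ?thesis using distinct_card[of "[x\<leftarrow>c. x \<notin> X1]"] c(3) by simp
  qed
  ultimately have fold: "fold g c (0, 0) = (card (set c \<inter> X1), card (set c \<inter> X2))" by simp
  have "ev (cluster_val c # row_val w # E) count_prog (ea (fold g c (0, 0)))
     (1 + 3 + length c * ((45 * n + 40) + 17) + 10)"
    unfolding count_prog_def
  proof (rule ev_Fold[where ex = nat_val and Inv = "\<lambda>_. True"])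
    show "ev (cluster_val c # row_val w # E) (Var 0) (list_val (map nat_val c)) 1"
      unfolding cluster_val_def by (rule ev_Var)
    show "ev (cluster_val c # row_val w # E) (Op2 MkCell (Const 0) (Const 0)) (ea (0, 0)) 3"
      unfolding ea_def by (rule ev_cong, (rule ev_straight)+) auto
    fix x st and a :: "nat \<times> nat" assume "x \<in> set c"
    then have x: "x < length w" "w ! x = (if x \<in> X1 then 1 else 2)" using c w by auto
    obtain i j where a: "a = (i, j)" by (cases a)
    show "ev (ea a # nat_val x # st # cluster_val c # row_val w # E)
      (Bind (Bind (Var 4) (Bind (Var 2) nth_prog))
       (Ite (Op2 Less (Var 0) (Const 2))
         (Op2 MkCell (Op2 Plus (Op1 Fst (Var 1)) (Const 1)) (Op1 Snd (Var 1)))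
         (Op2 MkCell (Op1 Fst (Var 1)) (Op2 Plus (Op1 Snd (Var 1)) (Const 1)))))
      (ea (g x a)) (45 * n + 40)"
      unfolding a ea_def g_def prod.case
      by (rule ev_cong, (rule ev_straight ev_Ite ev_nth_row[OF x(1)])+) (use x w in auto)
  qed auto
  then show ?thesis unfolding w_def[symmetric]
  proof (rule ev_cong)
    have "1 + 3 + length c * ((45 * n + 40) + 17) + 10 \<le> (102 + 14) * (n * n)"
      using c n by (intro fold_time) auto
    then show "1 + 3 + length c * ((45 * n + 40) + 17) + 10 \<le> 150 * n ^ 2"
      by (simp add: power2_eq_square)
  qed (simp add: fold ea_def)
qed

definition fair_prog :: prog where
  "fair_prog = Fold (Op1 Fst (Op1 Snd (Op1 Snd (Op1 Snd (Var 0))))) (Const 1)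
     (Bind (Bind (Op1 Fst (Op1 Fst (Op1 Snd (Op1 Snd (Var 3))))) (Bind (Var 2) count_prog))
       (Bind (Op1 Fst (Op1 Snd (Op1 Fst (Op1 Snd (Op1 Snd (Var 4))))))
         (Ite (Op2 Less (Op1 Snd (Var 1)) (Op2 Times (Var 0) (Op1 Fst (Var 1)))) (Const 0)
           (Ite (Op2 Less (Op1 Fst (Var 1)) (Op2 Times (Var 0) (Op1 Snd (Var 1)))) (Const 0) (Var 2)))))"

lemma ev_fair:
  assumes cs: "clustering n cs" and X: "X1 \<union> X2 = {..<n}" "X1 \<inter> X2 = {}" and b: "0 \<le> b" and n: "1 \<le> n"
  shows "ev [list_val [N, M, list_val [list_val (map (\<lambda>i. nat_val (if i \<in> X1 then 1 else 2)) [0..<n]), Num b],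
      clusters_val cs]] fair_prog (truth (\<forall>c\<in>set cs. balanced X1 X2 b (set c))) (300 * n ^ 3)"
proof -
  define w where "w = row_val (map (\<lambda>i. if i \<in> X1 then 1 else 2) [0..<n])"
  define inp where "inp = Cell N (Cell M (Cell (Cell w (Cell (Num b) Null)) (Cell (clusters_val cs) Null)))"
  define g where "g c acc \<longleftrightarrow> acc \<and> balanced X1 X2 b (set c)" for c acc
  have fold: "fold g cs True \<longleftrightarrow> (\<forall>c\<in>set cs. balanced X1 X2 b (set c))"
  proof -
    have "fold g cs a \<longleftrightarrow> a \<and> (\<forall>c\<in>set cs. balanced X1 X2 b (set c))" for a
      by (induction cs arbitrary: a) (auto simp: g_def)
    then show ?thesis by simp
  qed
  \<comment> \<open>The colour list has the shape of a matrix row, so the row lookup applies to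
    it.\<close>
  have w_eq: "list_val (map (\<lambda>i. nat_val (if i \<in> X1 then 1 else 2)) [0..<n]) = w"
    unfolding w_def row_val_def by (auto simp: nat_val_def comp_def intro!: arg_cong[of _ _ list_val])
  have "ev [inp] fair_prog (truth (fold g cs True)) (5 + 1 + length cs * ((150 * n ^ 2 + 50) + 17) + 10)"
    unfolding fair_prog_def
  proof (rule ev_Fold[where ex = cluster_val and Inv = "\<lambda>_. True"])
    show "ev [inp] (Op1 Fst (Op1 Snd (Op1 Snd (Op1 Snd (Var 0))))) (list_val (map cluster_val cs)) 5"
      unfolding inp_def clusters_val_eq by (rule ev_cong, (rule ev_straight)+) auto
    show "ev [inp] (Const 1) (truth True) 1" unfolding truth_def if_True by (rule ev_Const)
    fix c a st assume c: "c \<in> set cs"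
    have dc: "distinct c" using cs c distinct_concat_member unfolding clustering_def by blast
    have ne: "set c \<noteq> {}" using cs c unfolding clustering_def by auto
    have sub: "set c \<subseteq> X1 \<union> X2" using clustering_member(1)[OF cs c] X by auto
    note cnt = ev_count[OF clustering_member(2,1)[OF cs c] dc sub X(2) n, folded w_def]
    show "ev [truth a, cluster_val c, st, inp]
      (Bind (Bind (Op1 Fst (Op1 Fst (Op1 Snd (Op1 Snd (Var 3))))) (Bind (Var 2) count_prog))
       (Bind (Op1 Fst (Op1 Snd (Op1 Fst (Op1 Snd (Op1 Snd (Var 4))))))
         (Ite (Op2 Less (Op1 Snd (Var 1)) (Op2 Times (Var 0) (Op1 Fst (Var 1)))) (Const 0)
           (Ite (Op2 Less (Op1 Fst (Var 1)) (Op2 Times (Var 0) (Op1 Snd (Var 1)))) (Const 0) (Var 2)))))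
      (truth (g c a)) (150 * n ^ 2 + 50)"
      unfolding inp_def
      by (rule ev_cong, (rule cnt ev_straight ev_Ite)+)
        (auto simp: g_def truth_def balanced_iff[OF _ ne sub b])
  qed (rule TrueI)+
  then have "ev [inp] fair_prog (truth (fold g cs True)) (300 * n ^ 3)"
  proof (rule ev_mono)
    have "5 + 1 + length cs * ((150 * n ^ 2 + 50) + 17) + 10 \<le> (217 + 16) * (n * n ^ 2)"
      using clustering_length[OF cs] n by (intro fold_time) auto
    then show "5 + 1 + length cs * ((150 * n ^ 2 + 50) + 17) + 10 \<le> 300 * n ^ 3"
      by (simp flip: power_Suc)
  qed
  then show ?thesis unfolding w_eq fold inp_def by simp
qed

lemma checks_fair: "checks_feasibility fair_prog (\<lambda>n. 300 * n ^ 3) fair_msd"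
  unfolding checks_feasibility_def
proof (intro ballI allI impI)
  fix I P cs assume "I \<in> fair_msd" and *: "partition_on (points I) P \<and> lists_partition cs P"
  then obtain n d X1 X2 b where I: "I = fair_instance n d X1 X2 b" and n: "1 \<le> n"
    and X: "X1 \<union> X2 = {..<n}" "X1 \<inter> X2 = {}" and b: "0 \<le> b" "b \<le> 1"
    unfolding fair_msd_def by blast
  have pts: "points I = {..<n}" "num_points I = n" by (simp_all add: points_def I fair_instance_def)
  have P: "set ` set cs = P" using * by (simp add: lists_partition_def)
  have "clustering n cs"
    using * partition_onD1[of "{..<n}" P] unfolding lists_partition_def clustering_def pts by auto
  from ev_fair[OF this X b(1) n, of "nat_val n" "matrix_val n d"]
  obtain t where t: "t \<le> 300 * n ^ 3" "run [list_val (instance_vals I @ [clusters_val cs])] fair_prog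
      (truth (\<forall>c\<in>set cs. balanced X1 X2 b (set c))) t"
    unfolding ev_def by (auto simp: instance_vals_def I fair_instance_def)
  moreover have "(\<forall>c\<in>set cs. balanced X1 X2 b (set c)) \<longleftrightarrow> P \<in> feasible I"
    using * pts P by (auto simp: I fair_instance_def)
  ultimately show "\<exists>t\<le>300 * num_points I ^ 3. run [list_val (instance_vals I @ [clusters_val cs])] fair_prog
      (truth (P \<in> feasible I)) t" by (auto simp: pts)
qed

lemma solves_within_mono: "solves_within q I k T \<Longrightarrow> T \<le> T' \<Longrightarrow> solves_within q I k T'"
  unfolding solves_within_def by (meson order_trans)

theorem mainTheorem13:
  shows "(\<exists>c::nat. \<forall>\<P> p f. mergeable_msd_problem \<P> \<and> checks_feasibility p f \<P> \<longrightarrow>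
            (\<exists>q. \<forall>I\<in>\<P>. \<forall>k\<ge>1.
               solves_within q I k (c * num_points I ^ (c * k) * f (num_points I))))
       \<and> (\<exists>(c::nat) q. \<forall>I\<in>fair_msd. \<forall>k\<ge>1.
               solves_within q I k (c * num_points I ^ (c * k)))"
proof -
  \<comment> \<open>One constant has to serve as factor and in the exponent. The factor 1200 comes
    from \<open>search_solves\<close>; the exponent \<open>2 * (k - 1) + 6\<close> is far below
    \<open>1200 * k\<close>.\<close>
  define T where "T n k F = 1200 * n ^ (1200 * k) * F" for n k F :: nat
  have main: "solves_within (search_prog p) I k (T (num_points I) k (f (num_points I)))"
    if "mergeable_msd_problem \<P>" "checks_feasibility p f \<P>" "I \<in> \<P>" "1 \<le> k" for \<P> p f I k
  proof (rule solves_within_mono[OF search_solves[OF that(3,1,2,4)]])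
    let ?n = "num_points I"
    have "1 \<le> ?n" using that unfolding mergeable_msd_problem_def valid_instance_def by blast
    then have "?n ^ (2 * (k - 1)) * ?n ^ 6 \<le> ?n ^ (1200 * k)"
      unfolding power_add[symmetric] using that(4) by (intro power_increasing) auto
    then show "1200 * (?n ^ (2 * (k - 1)) * ?n ^ 6 * f ?n) \<le> T ?n k (f ?n)"
      unfolding T_def by (simp add: mult.assoc[symmetric])
  qed
  \<comment> \<open>The factor is 1200 times the 300 of the fairness check, whose cube of
    \<open>n\<close> fits into the larger exponent.\<close>
  have "solves_within (search_prog fair_prog) I k (360000 * num_points I ^ (360000 * k))"
    if I: "I \<in> fair_msd" and k: "1 \<le> k" for I k
  proof (rule solves_within_mono[OF main[OF mergeable_fair checks_fair I k]])
    let ?n = "num_points I"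
    have "1 \<le> ?n" using mergeable_fair I unfolding mergeable_msd_problem_def valid_instance_def by blast
    then have "?n ^ (1200 * k) * ?n ^ 3 \<le> ?n ^ (360000 * k)"
      unfolding power_add[symmetric] using k by (intro power_increasing) auto
    then show "T ?n k (300 * ?n ^ 3) \<le> 360000 * ?n ^ (360000 * k)" unfolding T_def by simp
  qed
  then show ?thesis using main unfolding T_def by blast
qed

end
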